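(* Let $k$ be an algebraically closed field of characteristic $0$, let $n\ge 2$, and let $Q=\{r,\,p_{i,j}\}_{1\le i<j\le n}$ be nonzero elements of $k$ with $r\neq 1$. Let $V=\mathrm{Sp}_k\{x_1,\dots,x_{n-1}\}$ and $SLG$ be the Yetter-Drinfeld module and the abelian group attached to $Q$ as in the context. Then the Hopf algebra $B(V)\#kSLG$ (where $B(V)$ is the Nichols algebra of $V$) is of Cartan type $A_{n-1}$: if $c$ denotes the braiding of the Yetter-Drinfeld module $V$ over $kSLG$ and $c(x_i\otimes x_j)=l_{ij}\,(x_j\otimes x_i)$ with $l_{ij}\in k$, then the braiding $c$ is of Cartan-FL-type with Cartan matrix $(a_{ij})_{1\le i,j\le n-1}$ of type $A_{n-1}$.
   Context: Notation. Put $q_{i,j}=r/p_{i,j}$ for $i<j$. For $1\le i,j\le n$ set $\kappa_j^i=p_{i,j}$ if $i<j$, $\kappa_j^i=r$ if $i=j$, and $\kappa_j^i=q_{j,i}=r/p_{j,i}$ if $i>j$. Let $R_{ij}^{kl}=\kappa^i_j$ if $i=l,\ j=k$; $R_{ij}^{kl}=r-1$ if $i=k,\ j=l,\ i>j$; and $R_{ij}^{kl}=0$ otherwise. These are the coefficients of the Yang-Baxter operator $R_Q(v_i\otimes v_j)=\sum_{k,l} R_{ij}^{kl}v_k\otimes v_l$ on a space with basis $v_1,\dots,v_n$. $A(R_Q)$ is the associated Faddeev-Reshetikhin-Takhtajan bialgebra: the $k$-algebra generated by $T_i^j$ ($1\le i,j\le n$) with relations $\sum_{k,l}R_{ij}^{kl}T_k^aT_l^b=\sum_{k,l}T_i^kT_j^lR_{kl}^{ab}$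 for all $i,j,a,b$, with $\Delta(T_i^j)=\sum_k T_i^k\otimes T_k^j$ and $\varepsilon(T_i^j)=\delta_{ij}$. In the finite dual bialgebra $A(R_Q)^0$ (convolution product; coproduct determined by $u(ab)=\sum u_{(1)}(a)u_{(2)}(b)$) one has, for $1\le i\le n$, the group-like elements (algebra homomorphisms to $k$) $K_i(T_j^l)=\delta_{jl}\kappa_j^i$, which are convolution invertible, and for $1\le i\le n-1$ the elements $E_{i+1}^i$ determined by $E_{i+1}^i(T_k^l)=\delta_{k,i}\delta_{l,i+1}$ and $\Delta(E_{i+1}^i)=K_{i+1}\otimes E_{i+1}^i+E_{i+1}^i\otimes K_i$. Let $B^l$ be the Hopf algebra generated inside $A(R_Q)^0$ by $K_j^{\pm1}$ ($1\le j\le n$) and $E^i_{i+1}$ ($1\le i\le n-1$). It is pointed with abelian group of group-likes $G(B^l)$. Let $\mathrm{gr}\,B^l$ be the graded Hopf algebra associated with the coradical filtration, $\pi:\mathrm{gr}\,B^l\to kG(B^l)$ the projection onto degree $0$, and $\mathrm{gr}\,B^l\cong R\#kG(B^l)$ the resulting biproduct (Radford-Majid bosonization), where $R=\{x:(\mathrm{id}\otimes\pi)\Delta(x)=x\otimes1\}$ is a braided Hopf algebra in left Yetter-Drinfeld modules over $kG(B^l)$ with adjoint action of the group and coaction $\rho=(\pi\otimes \mathrm{id})\Delta$. The elements $x_i:=E_{i+1}^iK_i^{-1}$ ($1\le i\le n-1$), viewed in $\mathrm{gr}\,B^l$, are primitive elements of $R$, with $\rho(x_i)=K_i^{-1}K_{i+1}\otimes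 x_i$. Set $V=\mathrm{Sp}_k\{x_1,\dots,x_{n-1}\}$, and let $SLG$ be the group generated by $\overline{K_i}:=K_i^{-1}K_{i+1}$, $1\le i\le n-1$. Then $V$ is a left Yetter-Drinfeld module over $kSLG$ (adjoint action, coaction $\rho$), with braiding $c(v\otimes w)=\sum (v_{-1}\cdot w)\otimes v_0$, where $\rho(v)=\sum v_{-1}\otimes v_0$. The Nichols algebra $B(V)$ is the subalgebra of $R$ generated by $V$, so $B(V)\#kSLG\subset\mathrm{gr}\,B^l$. A braiding $c(x_i\otimes x_j)=l_{ij}(x_j\otimes x_i)$ is of Cartan-FL-type with Cartan matrix $(a_{ij})$ if there exist $q\in k$, $q\neq1$, and positive integers $d_i$ such that $l_{ij}l_{ji}=q^{d_ia_{ij}}$ for all $i,j$, where $(a_{ij})$ is a generalized symmetrizable Cartan matrix with $d_ia_{ij}=d_ja_{ji}$. Type $A_{n-1}$ means $a_{ii}=2$, $a_{ij}=-1$ for $|i-j|=1$, and $a_{ij}=0$ for $|i-j|\ge2$. *)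

theory Defs
  imports
    "HOL-Library.Poly_Mapping"
    "HOL-Library.Product_Plus"
    "HOL-Library.Function_Algebras"
    "HOL-Library.Set_Algebras"
    "HOL-Computational_Algebra.Polynomial"
    "HOL-Algebra.Generated_Groups"
begin

section \<open>The free algebra on the symbols T\<close>

text \<open>The letter \<open>(i, j)\<close> stands for the generator \<open>T_i^j\<close>. Monomials are written additively, so
  that the convolution ring \<open>monomial \<Rightarrow>\<^sub>0 'k\<close> of \<^theory>\<open>HOL-Library.Poly_Mapping\<close> is the free
  associative algebra, and the ring of finitely supported functions on pairs of monomials is its
  tensor square.\<close>

datatype monomial = Mon (letters: "(nat \<times> nat) list")

instantiation monomial :: monoid_add
begin
definition zero_monomial where "0 = Mon []"
definition plus_monomial where "a + b = Mon (letters a @ letters b)"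
instance
  by standard (simp_all add: zero_monomial_def plus_monomial_def)
end

type_synonym 'k free_alg = "monomial \<Rightarrow>\<^sub>0 'k"
type_synonym 'k free_alg2 = "(monomial \<times> monomial) \<Rightarrow>\<^sub>0 'k"

abbreviation T_gen :: "nat \<Rightarrow> nat \<Rightarrow> 'k::field free_alg" where
  "T_gen i j \<equiv> Poly_Mapping.single (Mon [(i, j)]) 1"

definition fa_scale :: "'k::field \<Rightarrow> ('b::monoid_add \<Rightarrow>\<^sub>0 'k) \<Rightarrow> ('b \<Rightarrow>\<^sub>0 'k)" where
  "fa_scale c f = Poly_Mapping.single 0 c * f"

global_interpretation fa: vector_space fa_scale
  by unfold_locales
    (simp_all add: fa_scale_def algebra_simps single_add mult_single mult.assoc[symmetric])

definition two_sided_ideal :: "'a::ring_1 set \<Rightarrow> bool" where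
  "two_sided_ideal J \<longleftrightarrow> 0 \<in> J \<and> (\<forall>x\<in>J. \<forall>y\<in>J. x + y \<in> J) \<and> (\<forall>x\<in>J. \<forall>a. a * x \<in> J \<and> x * a \<in> J)"

definition finite_codim :: "'k::field free_alg set \<Rightarrow> bool" where
  "finite_codim J \<longleftrightarrow> (\<exists>S. finite S \<and> fa.span (S \<union> J) = UNIV)"

section \<open>Spaces of functions and their tensor products\<close>

definition fscale :: "'k::field \<Rightarrow> ('a \<Rightarrow> 'k) \<Rightarrow> ('a \<Rightarrow> 'k)" where
  "fscale c f = (\<lambda>x. c * f x)"

global_interpretation fs: vector_space fscale
  by unfold_locales (simp_all add: fscale_def fun_eq_iff algebra_simps)

text \<open>The tensor product of two spaces of functions is realised as a space of functions of two
  variables; over a field the map from the abstract tensor product is injective.\<close>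

definition tensor :: "('a \<Rightarrow> 'k::field) \<Rightarrow> ('b \<Rightarrow> 'k) \<Rightarrow> ('a \<times> 'b \<Rightarrow> 'k)" where
  "tensor f g = (\<lambda>(x, y). f x * g y)"

definition tensor_space :: "('a \<Rightarrow> 'k::field) set \<Rightarrow> ('b \<Rightarrow> 'k) set \<Rightarrow> ('a \<times> 'b \<Rightarrow> 'k) set" where
  "tensor_space U W = fs.span {tensor f g | f g. f \<in> U \<and> g \<in> W}"

text \<open>The coproduct dual to a multiplication: \<open>u(ab) = \<Sum> u\<^sub>1(a) u\<^sub>2(b)\<close>.\<close>

definition coprod :: "('a::times \<Rightarrow> 'k) \<Rightarrow> ('a \<times> 'a \<Rightarrow> 'k)" where
  "coprod u = (\<lambda>(a, b). u (a * b))"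

section \<open>Coradical filtration and associated graded object\<close>

definition subcoalgebra :: "('a::times \<Rightarrow> 'k::field) set \<Rightarrow> bool" where
  "subcoalgebra C \<longleftrightarrow> fs.subspace C \<and> coprod ` C \<subseteq> tensor_space C C"

definition simple_subcoalgebra :: "('a::times \<Rightarrow> 'k::field) set \<Rightarrow> bool" where
  "simple_subcoalgebra C \<longleftrightarrow>
     subcoalgebra C \<and> C \<noteq> {0} \<and> (\<forall>D. subcoalgebra D \<and> D \<subseteq> C \<longrightarrow> D = {0} \<or> D = C)"

definition coradical :: "('a::times \<Rightarrow> 'k::field) set \<Rightarrow> ('a \<Rightarrow> 'k) set" where
  "coradical B = fs.span (\<Union>{C. C \<subseteq> B \<and> simple_subcoalgebra C})"

primrec corad_filt :: "('a::times \<Rightarrow> 'k::field) set \<Rightarrow> nat \<Rightarrow> ('a \<Rightarrow> 'k) set" where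
  "corad_filt B 0 = coradical B"
| "corad_filt B (Suc m) =
     {u \<in> B. coprod u \<in> tensor_space B (corad_filt B m) + tensor_space (coradical B) B}"

definition corad_below :: "('a::times \<Rightarrow> 'k::field) set \<Rightarrow> nat \<Rightarrow> ('a \<Rightarrow> 'k) set" where
  "corad_below B m = (case m of 0 \<Rightarrow> {0} | Suc m' \<Rightarrow> corad_filt B m')"

text \<open>\<open>gr B\<close> in degree \<open>m\<close> is \<open>B\<^sub>m / B\<^sub>m\<^sub>-\<^sub>1\<close> with \<open>B\<^sub>-\<^sub>1 = 0\<close>; its elements are cosets. The component of
  \<open>gr B \<otimes> gr B\<close> in bidegree \<open>(i, j)\<close> is the quotient of \<open>B\<^sub>i \<otimes> B\<^sub>j\<close> by the kernel \<open>gr_ker2 B i j\<close>.\<close>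

definition gr_class :: "('a::times \<Rightarrow> 'k::field) set \<Rightarrow> nat \<Rightarrow> ('a \<Rightarrow> 'k) \<Rightarrow> ('a \<Rightarrow> 'k) set" where
  "gr_class B m u = u +o corad_below B m"

definition gr_ker2 :: "('a::times \<Rightarrow> 'k::field) set \<Rightarrow> nat \<Rightarrow> nat \<Rightarrow> ('a \<times> 'a \<Rightarrow> 'k) set" where
  "gr_ker2 B i j =
     tensor_space (corad_below B i) (corad_filt B j) + tensor_space (corad_filt B i) (corad_below B j)"

definition gr_tensor :: "('a::times \<Rightarrow> 'k::field) set \<Rightarrow> nat \<Rightarrow> nat \<Rightarrow>
    ('a \<Rightarrow> 'k) set \<Rightarrow> ('a \<Rightarrow> 'k) set \<Rightarrow> ('a \<times> 'a \<Rightarrow> 'k) set" where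
  "gr_tensor B i j X Y = (\<Union>u\<in>X. \<Union>v\<in>Y. tensor u v +o gr_ker2 B i j)"

text \<open>The component of the coproduct of \<open>gr B\<close> from degree \<open>i + j\<close> to bidegree \<open>(i, j)\<close>: write
  \<open>\<Delta>(u) \<in> \<Sum>\<^sub>k B\<^sub>k \<otimes> B\<^sub>i\<^sub>+\<^sub>j\<^sub>-\<^sub>k\<close> and keep the summand \<open>s\<close> with \<open>k = i\<close>, which is determined modulo
  \<open>gr_ker2 B i j\<close>.\<close>

definition gr_coprod :: "('a::times \<Rightarrow> 'k::field) set \<Rightarrow> nat \<Rightarrow> nat \<Rightarrow>
    ('a \<Rightarrow> 'k) set \<Rightarrow> ('a \<times> 'a \<Rightarrow> 'k) set" where
  "gr_coprod B i j X =
     {s \<in> tensor_space (corad_filt B i) (corad_filt B j).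
        \<exists>u\<in>X. coprod u \<in> s +o (\<Sum>k\<in>{0..i+j} - {i}. tensor_space (corad_filt B k) (corad_filt B (i + j - k)))}"

definition gr_scale2 :: "('a::times \<Rightarrow> 'k::field) set \<Rightarrow> nat \<Rightarrow> nat \<Rightarrow> 'k \<Rightarrow>
    ('a \<times> 'a \<Rightarrow> 'k) set \<Rightarrow> ('a \<times> 'a \<Rightarrow> 'k) set" where
  "gr_scale2 B i j c X = fscale c ` X + gr_ker2 B i j"

section \<open>The FRT bialgebra, its finite dual and the Hopf algebra B\<close>

context
  fixes n :: nat and r :: "'k::field" and p :: "nat \<Rightarrow> nat \<Rightarrow> 'k"
begin

text \<open>\<open>kappa i j\<close> is \<open>\<kappa>\<^sub>j\<^sup>i\<close> (upper index first) and \<open>R_coeff i j k l\<close> is \<open>R_{ij}^{kl}\<close>.\<close>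

definition kappa :: "nat \<Rightarrow> nat \<Rightarrow> 'k" where
  "kappa i j = (if i < j then p i j else if i = j then r else r / p j i)"

definition R_coeff :: "nat \<Rightarrow> nat \<Rightarrow> nat \<Rightarrow> nat \<Rightarrow> 'k" where
  "R_coeff i j k l =
     (if i = l \<and> j = k then kappa i j else if i = k \<and> j = l \<and> i > j then r - 1 else 0)"

definition frt_relator :: "nat \<Rightarrow> nat \<Rightarrow> nat \<Rightarrow> nat \<Rightarrow> 'k free_alg" where
  "frt_relator i j a b =
     (\<Sum>k=1..n. \<Sum>l=1..n. fa_scale (R_coeff i j k l) (T_gen k a * T_gen l b))
     - (\<Sum>k=1..n. \<Sum>l=1..n. fa_scale (R_coeff k l a b) (T_gen i k * T_gen j l))"

text \<open>\<open>A(R\<^sub>Q)\<close> is the free algebra modulo \<open>frt_ideal\<close>. Letters are indexed by all pairs of naturals, so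
  the surplus generators (an index outside \<open>{1..n}\<close>) are set to zero along with the relators.\<close>

definition frt_ideal :: "'k free_alg set" where
  "frt_ideal = \<Inter>{J. two_sided_ideal J
     \<and> {frt_relator i j a b | i j a b. {i, j, a, b} \<subseteq> {1..n}} \<subseteq> J
     \<and> {T_gen i j | i j. \<not> {i, j} \<subseteq> {1..n}} \<subseteq> J}"

definition Delta_mon :: "monomial \<Rightarrow> 'k free_alg2" where
  "Delta_mon w =
     (\<Prod>(i, j)\<leftarrow>letters w. \<Sum>k=1..n. Poly_Mapping.single (Mon [(i, k)], Mon [(k, j)]) 1)"

definition Delta :: "'k free_alg \<Rightarrow> 'k free_alg2" where
  "Delta f = (\<Sum>w\<in>Poly_Mapping.keys f. fa_scale (Poly_Mapping.lookup f w) (Delta_mon w))"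

text \<open>The algebra homomorphism from the free algebra to \<open>k\<close> with prescribed values on generators.\<close>

definition char_of :: "(nat \<Rightarrow> nat \<Rightarrow> 'k) \<Rightarrow> 'k free_alg \<Rightarrow> 'k" where
  "char_of t f = (\<Sum>w\<in>Poly_Mapping.keys f. Poly_Mapping.lookup f w * (\<Prod>(i, j)\<leftarrow>letters w. t i j))"

definition counit :: "'k free_alg \<Rightarrow> 'k" where
  "counit = char_of (\<lambda>i j. if i = j \<and> i \<in> {1..n} then 1 else 0)"

text \<open>Functionals on \<open>A(R\<^sub>Q)\<close> are functionals on the free algebra that vanish on \<open>frt_ideal\<close>; ideals of
  \<open>A(R\<^sub>Q)\<close> are ideals of the free algebra containing \<open>frt_ideal\<close>.\<close>

definition finite_dual :: "('k free_alg \<Rightarrow> 'k) set" where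
  "finite_dual = {u. Vector_Spaces.linear fa_scale (*) u \<and>
     (\<exists>J. two_sided_ideal J \<and> frt_ideal \<subseteq> J \<and> finite_codim J \<and> (\<forall>x\<in>J. u x = 0))}"

definition convol :: "('k free_alg \<Rightarrow> 'k) \<Rightarrow> ('k free_alg \<Rightarrow> 'k) \<Rightarrow> ('k free_alg \<Rightarrow> 'k)" where
  "convol u v f = (\<Sum>(a, b)\<in>Poly_Mapping.keys (Delta f).
     Poly_Mapping.lookup (Delta f) (a, b) * u (Poly_Mapping.single a 1) * v (Poly_Mapping.single b 1))"

definition dual_monoid :: "('k free_alg \<Rightarrow> 'k) monoid" where
  "dual_monoid = \<lparr>carrier = finite_dual, mult = convol, one = counit\<rparr>"

definition K :: "nat \<Rightarrow> 'k free_alg \<Rightarrow> 'k" where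
  "K i = char_of (\<lambda>j l. if j = l \<and> j \<in> {1..n} then kappa i j else 0)"

text \<open>\<open>E i\<close> is \<open>E_{i+1}^i\<close>. On monomials it is computed from \<open>E(ab) = K\<^sub>i\<^sub>+\<^sub>1(a) E(b) + E(a) K\<^sub>i(b)\<close>, which
  also forces \<open>E(1) = 0\<close>.\<close>

primrec E_word :: "nat \<Rightarrow> (nat \<times> nat) list \<Rightarrow> 'k" where
  "E_word i [] = 0"
| "E_word i (x # w) =
     K (Suc i) (Poly_Mapping.single (Mon [x]) 1) * E_word i w
     + (if x = (i, Suc i) then 1 else 0) * K i (Poly_Mapping.single (Mon w) 1)"

definition E :: "nat \<Rightarrow> 'k free_alg \<Rightarrow> 'k" where
  "E i f = (\<Sum>w\<in>Poly_Mapping.keys f. Poly_Mapping.lookup f w * E_word i (letters w))"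

text \<open>The subalgebra generated by the \<open>K\<^sub>j\<close>, their inverses and the \<open>E i\<close>. As the generators are
  group-like and skew-primitive, it is a Hopf algebra.\<close>

inductive_set Bl :: "('k free_alg \<Rightarrow> 'k) set" where
  K: "1 \<le> j \<Longrightarrow> j \<le> n \<Longrightarrow> K j \<in> Bl"
| K_inv: "1 \<le> j \<Longrightarrow> j \<le> n \<Longrightarrow> inv\<^bsub>dual_monoid\<^esub> (K j) \<in> Bl"
| E: "1 \<le> i \<Longrightarrow> i < n \<Longrightarrow> E i \<in> Bl"
| unit: "counit \<in> Bl"
| add: "u \<in> Bl \<Longrightarrow> v \<in> Bl \<Longrightarrow> u + v \<in> Bl"
| scale: "u \<in> Bl \<Longrightarrow> fscale c u \<in> Bl"
| convol: "u \<in> Bl \<Longrightarrow> v \<in> Bl \<Longrightarrow> convol u v \<in> Bl"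

section \<open>The Yetter-Drinfeld module V and its braiding\<close>

definition gr_mult :: "nat \<Rightarrow> nat \<Rightarrow>
    ('k free_alg \<Rightarrow> 'k) set \<Rightarrow> ('k free_alg \<Rightarrow> 'k) set \<Rightarrow> ('k free_alg \<Rightarrow> 'k) set" where
  "gr_mult i j X Y = (\<Union>u\<in>X. \<Union>v\<in>Y. gr_class Bl (i + j) (convol u v))"

definition x_elt :: "nat \<Rightarrow> 'k free_alg \<Rightarrow> 'k" where
  "x_elt i = convol (E i) (inv\<^bsub>dual_monoid\<^esub> (K i))"

definition x_gr :: "nat \<Rightarrow> ('k free_alg \<Rightarrow> 'k) set" where
  "x_gr i = gr_class Bl 1 (x_elt i)"

definition V_gr :: "('k free_alg \<Rightarrow> 'k) set set" where
  "V_gr = gr_class Bl 1 ` fs.span (x_elt ` {1..n-1})"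

definition SLG :: "('k free_alg \<Rightarrow> 'k) set" where
  "SLG = generate dual_monoid {convol (inv\<^bsub>dual_monoid\<^esub> (K i)) (K (Suc i)) | i. i \<in> {1..n-1}}"

definition ad_act :: "('k free_alg \<Rightarrow> 'k) \<Rightarrow> ('k free_alg \<Rightarrow> 'k) set \<Rightarrow> ('k free_alg \<Rightarrow> 'k) set" where
  "ad_act g X =
     gr_mult 1 0 (gr_mult 0 1 (gr_class Bl 0 g) X) (gr_class Bl 0 (inv\<^bsub>dual_monoid\<^esub> g))"

text \<open>The projection of \<open>gr B\<close> onto degree \<open>0\<close> being \<open>\<pi>\<close>, the coaction \<open>(\<pi> \<otimes> id)\<Delta>\<close> on degree \<open>1\<close> is
  the component of the coproduct in bidegree \<open>(0, 1)\<close>.\<close>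

definition coact :: "('k free_alg \<Rightarrow> 'k) set \<Rightarrow> (('k free_alg \<times> 'k free_alg) \<Rightarrow> 'k) set" where
  "coact X = gr_coprod Bl 0 1 X"

text \<open>\<open>c(v \<otimes> w) = \<Sum> g\<^sub>t w \<otimes> v\<^sub>t\<close> for \<open>\<rho>(v) = \<Sum> g\<^sub>t \<otimes> v\<^sub>t\<close> with \<open>g\<^sub>t \<in> SLG\<close> and \<open>v\<^sub>t \<in> V\<close>. Scalars are absorbed
  in the \<open>v\<^sub>t\<close>. The result does not depend on how \<open>\<rho>(v)\<close> is written, so the union below is over
  copies of one and the same coset.\<close>

definition braiding :: "('k free_alg \<Rightarrow> 'k) set \<Rightarrow> ('k free_alg \<Rightarrow> 'k) set \<Rightarrow>
    (('k free_alg \<times> 'k free_alg) \<Rightarrow> 'k) set" where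
  "braiding X Y = \<Union>{(\<Sum>t<m. gr_tensor Bl 1 1 (ad_act (g t) Y) (v t)) + gr_ker2 Bl 1 1 | (m::nat) g v.
     (\<forall>t<m. g t \<in> SLG \<and> v t \<in> V_gr) \<and>
     coact X = (\<Sum>t<m. gr_tensor Bl 0 1 (gr_class Bl 0 (g t)) (v t)) + gr_ker2 Bl 0 1}"

definition braiding_has_matrix :: "(nat \<Rightarrow> nat \<Rightarrow> 'k) \<Rightarrow> bool" where
  "braiding_has_matrix l \<longleftrightarrow> (\<forall>i\<in>{1..n-1}. \<forall>j\<in>{1..n-1}.
     braiding (x_gr i) (x_gr j) = gr_scale2 Bl 1 1 (l i j) (gr_tensor Bl 1 1 (x_gr j) (x_gr i)))"

end

section \<open>Cartan-FL-type\<close>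

definition generalized_cartan_matrix :: "nat set \<Rightarrow> (nat \<Rightarrow> nat \<Rightarrow> int) \<Rightarrow> bool" where
  "generalized_cartan_matrix I a \<longleftrightarrow>
     (\<forall>i\<in>I. a i i = 2) \<and>
     (\<forall>i\<in>I. \<forall>j\<in>I. i \<noteq> j \<longrightarrow> a i j \<le> 0 \<and> (a i j = 0 \<longrightarrow> a j i = 0))"

text \<open>\<open>q \<noteq> 0\<close> is implicit in the use of negative powers of \<open>q\<close>.\<close>

definition cartan_FL_type ::
    "nat set \<Rightarrow> (nat \<Rightarrow> nat \<Rightarrow> 'k::field) \<Rightarrow> (nat \<Rightarrow> nat \<Rightarrow> int) \<Rightarrow> bool" where
  "cartan_FL_type I l a \<longleftrightarrow> generalized_cartan_matrix I a \<and>
     (\<exists>q (d :: nat \<Rightarrow> nat). q \<noteq> 0 \<and> q \<noteq> 1 \<and> (\<forall>i\<in>I. d i > 0) \<and>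
        (\<forall>i\<in>I. \<forall>j\<in>I. int (d i) * a i j = int (d j) * a j i \<and>
           l i j * l j i = q powi (int (d i) * a i j)))"

definition cartan_matrix_A :: "nat \<Rightarrow> nat \<Rightarrow> int" where
  "cartan_matrix_A i j = (if i = j then 2 else if i = Suc j \<or> j = Suc i then -1 else 0)"

end

theory Submission
  imports Defs
begin

text \<open>
  Every group-like element that occurs is a diagonal character \<open>T_a^b \<mapsto> \<delta>\<^sub>a\<^sub>b t\<^sub>a\<close>, and conjugation by it
  multiplies \<open>x\<^sub>j\<close> by \<open>t\<^sub>j / t\<^sub>j\<^sub>+\<^sub>1\<close> (\<open>conjugate_x\<close>). Since \<open>x\<^sub>i\<close> coacts by \<open>K\<^sub>i\<^sup>-\<^sup>1 K\<^sub>i\<^sub>+\<^sub>1\<close>, whose entries are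
  \<open>\<kappa>^{i+1}_j / \<kappa>^i_j\<close>, the braiding is diagonal with
  \<open>l\<^sub>i\<^sub>j = \<kappa>^{i+1}_j \<kappa>^i_{j+1} / (\<kappa>^{i+1}_{j+1} \<kappa>^i_j)\<close>. In \<open>l\<^sub>i\<^sub>j l\<^sub>j\<^sub>i\<close> the parameters \<open>p\<close> cancel, because
  \<open>\<kappa>^a_b \<kappa>^b_a = r\<close> for \<open>a \<noteq> b\<close>, and what remains is \<open>q^{a_{ij}}\<close> for \<open>q = 1/r\<close> and the Cartan matrix of type
  \<open>A_{n-1}\<close> (\<open>cartan_A\<close>).

  The braiding is an operation on classes in the associated graded object, so this computation rests on
  a description of the coradical \<open>B\<^sub>0\<close>: it is spanned by the group-like elements (\<open>coradical_B\<close>). The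
  functionals are studied through their values on words in the \<open>T_i^j\<close>. Those in \<open>B\<close> vanish on words
  with a letter below the diagonal and on words of large degree, where \<open>T_i^j\<close> has degree \<open>j - i\<close>, and
  their restriction to words of diagonal letters is a combination of group-like elements
  (\<open>B_structure\<close>). A nonzero subcoalgebra is closed under translations \<open>u \<mapsto> u(\<cdot> y)\<close>. Translation by a
  word of top degree produces a nonzero element of degree zero, and further translations separate the
  characters in it (\<open>translation_closed_contains_characters\<close>). So every nonzero subcoalgebra contains a
  group-like element, and every simple one is a line.

  Characters are linearly independent, hence linear forms can read off their coefficients in tensors.
  This determines the coaction on \<open>x\<^sub>i\<close> as the class of \<open>K\<^sub>i\<^sup>-\<^sup>1 K\<^sub>i\<^sub>+\<^sub>1 \<otimes> x\<^sub>i\<close> (\<open>coact_x\<close>) and shows that the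
  braiding does not depend on how the coaction is written as a sum (\<open>braiding_x\<close>). Evaluation at
  \<open>T_i^{i+1}\<close> vanishes on \<open>B\<^sub>0\<close> but not at \<open>x\<^sub>i\<close>, so the coefficients \<open>l\<^sub>i\<^sub>j\<close> exist and are unique
  (\<open>braiding_has_matrix_iff\<close>).
\<close>

section \<open>Tensor products of function spaces\<close>

lemma tensor_simps:
  fixes u v :: "'a \<Rightarrow> 'k::field" and w w' :: "'b \<Rightarrow> 'k"
  shows "tensor (u + v) w = tensor u w + tensor v w"
    and "tensor u (w + w') = tensor u w + tensor u w'"
    and "tensor (u - v) w = tensor u w - tensor v w"
    and "tensor u (w - w') = tensor u w - tensor u w'"
    and "tensor (fscale c u) w = fscale c (tensor u w)"
    and "tensor u (fscale c w) = fscale c (tensor u w)"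
    and "tensor 0 w = 0" and "tensor u 0 = 0"
  by (auto simp: tensor_def fscale_def fun_eq_iff algebra_simps)

lemma tensor_sum_right: "tensor u (\<Sum>t\<in>A. w t) = (\<Sum>t\<in>A. tensor u (w t))"
  by (induction A rule: infinite_finite_induct) (simp_all only: tensor_simps sum.infinite sum.empty sum.insert not_False_eq_True)

lemma subspace_tensor_space: "fs.subspace (tensor_space U W)"
  by (simp add: tensor_space_def)

lemma tensor_in_tensor_space: "u \<in> U \<Longrightarrow> w \<in> W \<Longrightarrow> tensor u w \<in> tensor_space U W"
  unfolding tensor_space_def by (rule fs.span_base) auto

lemma tensor_space_mono: "U \<subseteq> U' \<Longrightarrow> W \<subseteq> W' \<Longrightarrow> tensor_space U W \<subseteq> tensor_space U' W'"
  unfolding tensor_space_def by (rule fs.span_mono) blast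

lemma tensor_space_subset:
  assumes "fs.subspace S" "\<And>u w. u \<in> U \<Longrightarrow> w \<in> W \<Longrightarrow> tensor u w \<in> S"
  shows "tensor_space U W \<subseteq> S"
  unfolding tensor_space_def using assms by (intro fs.span_minimal) auto

lemma tensor_space_zero_left: "tensor_space {0} W \<subseteq> {0}"
  by (rule tensor_space_subset) (auto simp: fs.subspace_def tensor_simps)

lemma subspace_set_plus:
  assumes "fs.subspace U" "fs.subspace W" shows "fs.subspace (U + W)"
proof -
  have "U + W = {x + y |x y. x \<in> U \<and> y \<in> W}" by (auto simp: set_plus_def)
  then show ?thesis using fs.subspace_sums[OF assms] by simp
qed

text \<open>The map \<open>f \<otimes> id\<close>. It is defined on all functions of
  two variables, so no representation as a sum of pure tensors has to be chosen.\<close>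

definition contract :: "(('a \<Rightarrow> 'k) \<Rightarrow> 'k) \<Rightarrow> ('a \<times> 'b \<Rightarrow> 'k::field) \<Rightarrow> ('b \<Rightarrow> 'k)" where
  "contract f z = (\<lambda>b. f (\<lambda>a. z (a, b)))"

global_interpretation fsk: vector_space_pair fscale "(*) :: 'k::field \<Rightarrow> 'k \<Rightarrow> 'k"
  by unfold_locales (simp_all add: algebra_simps)

abbreviation linear_form :: "(('a \<Rightarrow> 'k::field) \<Rightarrow> 'k) \<Rightarrow> bool" where
  "linear_form \<equiv> Vector_Spaces.linear fscale (*)"

lemma contract_simps:
  assumes "linear_form f"
  shows "contract f (x + y) = contract f x + contract f y"
    and "contract f (x - y) = contract f x - contract f y"
    and "contract f (fscale c x) = fscale c (contract f x)"
    and "contract f 0 = 0"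
    and "contract f (tensor u w) = fscale (f u) w"
proof -
  interpret f: Vector_Spaces.linear fscale "(*)" f by fact
  show "contract f (x + y) = contract f x + contract f y"
    by (auto simp: contract_def fun_eq_iff f.add[symmetric] plus_fun_def)
  show "contract f (x - y) = contract f x - contract f y"
    by (auto simp: contract_def fun_eq_iff f.diff[symmetric] fun_diff_def)
  show "contract f (fscale c x) = fscale c (contract f x)"
    by (auto simp: contract_def fun_eq_iff f.scale[symmetric] fscale_def)
  show "contract f 0 = 0"
    using f.zero by (auto simp: contract_def fun_eq_iff zero_fun_def)
  have "(\<lambda>a. u a * w b) = fscale (w b) u" for b
    by (auto simp: fscale_def)
  moreover have "f (fscale (w b) u) = w b * f u" for b
    by (rule f.scale)
  ultimately show "contract f (tensor u w) = fscale (f u) w"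
    by (simp add: contract_def fun_eq_iff tensor_def) (simp add: fscale_def mult.commute)
qed

lemma contract_sum:
  assumes "linear_form f"
  shows "contract f (\<Sum>t\<in>A. z t) = (\<Sum>t\<in>A. contract f (z t))"
  by (induction A rule: infinite_finite_induct)
    (simp_all only: contract_simps[OF assms] sum.infinite sum.empty sum.insert not_False_eq_True)

lemma contract_in:
  assumes f: "linear_form f" and W: "fs.subspace W" and z: "z \<in> tensor_space U W"
  shows "contract f z \<in> W"
proof -
  have "tensor_space U W \<subseteq> {z. contract f z \<in> W}"
    using W by (intro tensor_space_subset)
      (auto simp: fs.subspace_def contract_simps[OF f])
  with z show ?thesis by auto
qed

lemma slice_left_in:
  fixes U :: "('a \<Rightarrow> 'k::field) set" and W :: "('b \<Rightarrow> 'k) set"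
  assumes "fs.subspace U" "z \<in> tensor_space U W"
  shows "(\<lambda>a. z (a, b)) \<in> U"
proof -
  have "tensor_space U W \<subseteq> {z. (\<lambda>a. z (a, b)) \<in> U}"
  proof (intro tensor_space_subset)
    have "(\<lambda>a. 0) \<in> U" using fs.subspace_0[OF assms(1)] by (simp add: zero_fun_def)
    moreover have "(\<lambda>a. x (a, b) + y (a, b)) \<in> U"
      if "(\<lambda>a. x (a, b)) \<in> U" "(\<lambda>a. y (a, b)) \<in> U" for x y
      using fs.subspace_add[OF assms(1) that] by (simp add: plus_fun_def)
    moreover have "(\<lambda>a. c * x (a, b)) \<in> U"
      if "(\<lambda>a. x (a, b)) \<in> U" for c x
      using fs.subspace_scale[OF assms(1) that] by (simp add: fscale_def)
    ultimately show "fs.subspace {z. (\<lambda>a. z (a, b)) \<in> U}"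
      by (auto simp: fs.subspace_def fscale_def)
    fix u w assume "u \<in> U" "w \<in> W"
    then show "tensor u w \<in> {z. (\<lambda>a. z (a, b)) \<in> U}"
      using fs.subspace_scale[OF assms(1), of u "w b"]
      by (simp add: tensor_def fscale_def mult.commute)
  qed
  with assms(2) show ?thesis by auto
qed

lemma tensor_space_span_left:
  assumes "z \<in> tensor_space (fs.span G) W" "fs.subspace W"
  obtains T w where "finite T" "T \<subseteq> G" "\<And>g. w g \<in> W" "z = (\<Sum>g\<in>T. tensor g (w g))"
proof -
  define P where "P z \<longleftrightarrow> (\<exists>T w. finite T \<and> T \<subseteq> G \<and> (\<forall>g. w g \<in> W) \<and> z = (\<Sum>g\<in>T. tensor g (w g)))" for z
  have add: "P (x + y)" if "P x" "P y" for x y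
  proof -
    obtain T w where T: "finite T" "T \<subseteq> G" "\<forall>g. w g \<in> W" "x = (\<Sum>g\<in>T. tensor g (w g))"
      using \<open>P x\<close> unfolding P_def by blast
    obtain S v where S: "finite S" "S \<subseteq> G" "\<forall>g. v g \<in> W" "y = (\<Sum>g\<in>S. tensor g (v g))"
      using \<open>P y\<close> unfolding P_def by blast
    let ?u = "\<lambda>g. (if g \<in> T then w g else 0) + (if g \<in> S then v g else 0)"
    have "(\<Sum>g\<in>T \<union> S. tensor g (?u g)) =
        (\<Sum>g\<in>T \<union> S. if g \<in> T then tensor g (w g) else 0) + (\<Sum>g\<in>T \<union> S. if g \<in> S then tensor g (v g) else 0)"
      unfolding sum.distrib[symmetric] by (rule sum.cong) (auto simp: tensor_simps)
    also have "\<dots> = x + y"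
    proof -
      have "(\<Sum>g\<in>T \<union> S. if g \<in> T then tensor g (w g) else 0) = x"
        unfolding T(4) by (rule sum.mono_neutral_cong_right) (use T S in auto)
      moreover have "(\<Sum>g\<in>T \<union> S. if g \<in> S then tensor g (v g) else 0) = y"
        unfolding S(4) by (rule sum.mono_neutral_cong_right) (use T S in auto)
      ultimately show ?thesis by simp
    qed
    finally have "x + y = (\<Sum>g\<in>T \<union> S. tensor g (?u g))" by simp
    moreover have "\<forall>g. ?u g \<in> W"
      using T(3) S(3) assms(2) by (auto intro!: fs.subspace_add fs.subspace_0)
    ultimately show ?thesis using T S unfolding P_def
      by (intro exI[of _ "T \<union> S"] exI[of _ ?u]) blast
  qed
  have scale: "P (fscale c x)" if "P x" for c x
  proof -
    obtain T w where T: "finite T" "T \<subseteq> G" "\<forall>g. w g \<in> W" "x = (\<Sum>g\<in>T. tensor g (w g))"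
      using \<open>P x\<close> unfolding P_def by blast
    then have "fscale c x = (\<Sum>g\<in>T. tensor g (fscale c (w g)))"
      by (simp add: fs.scale_sum_right tensor_simps)
    with T show ?thesis using fs.subspace_scale[OF assms(2)] unfolding P_def
      by (intro exI[of _ T] exI[of _ "\<lambda>g. fscale c (w g)"]) auto
  qed
  have zero: "P 0"
    using fs.subspace_0[OF assms(2)] unfolding P_def
    by (intro exI[of _ "{}"] exI[of _ "\<lambda>g. 0"]) (simp only: sum.empty finite.emptyI empty_subsetI simp_thms)
  have sub: "fs.subspace (Collect P)"
    unfolding fs.subspace_def mem_Collect_eq using add scale zero by blast
  have "P (tensor u w)" if "u \<in> fs.span G" "w \<in> W" for u w
  proof -
    have "fs.span G \<subseteq> {u. P (tensor u w)}"
    proof (rule fs.span_minimal)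
      show "G \<subseteq> {u. P (tensor u w)}"
      proof
        fix g assume "g \<in> G"
        then show "g \<in> {u. P (tensor u w)}" using \<open>w \<in> W\<close> unfolding P_def
          by (intro CollectI exI[of _ "{g}"] exI[of _ "\<lambda>_. w"]) auto
      qed
      show "fs.subspace {u. P (tensor u w)}"
        unfolding fs.subspace_def mem_Collect_eq tensor_simps using add scale zero by blast
    qed
    with that show ?thesis by blast
  qed
  then have "tensor_space (fs.span G) W \<subseteq> Collect P"
    by (intro tensor_space_subset sub) auto
  with assms(1) have "P z" by blast
  with that show thesis unfolding P_def by blast
qed

lemma independent_linear_form:
  assumes "fs.independent G"
  shows "\<exists>f. linear_form f \<and> (\<forall>g\<in>G. f g = \<phi> g)"
  using fsk.linear_independent_extend[OF assms, of \<phi>] by blast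

text \<open>For independent \<open>G\<close> the coefficients in \<open>z = \<Sum> g \<otimes> w\<^sub>g\<close> are obtained by contracting \<open>z\<close> with dual
  linear forms, and contracting the other representation of \<open>z\<close> shows that they lie in \<open>W'\<close>.\<close>

lemma tensor_space_Int:
  assumes G: "fs.independent G" and W: "fs.subspace W" "fs.subspace W'"
    and z: "z \<in> tensor_space (fs.span G) W" "z \<in> tensor_space U W'"
  shows "z \<in> tensor_space (fs.span G) W'"
proof -
  obtain T w where T: "finite T" "T \<subseteq> G" "z = (\<Sum>g\<in>T. tensor g (w g))"
    using tensor_space_span_left[OF z(1) W(1)] by metis
  have "w h \<in> W'" if "h \<in> T" for h
  proof -
    obtain f where f: "linear_form f" "\<forall>g\<in>G. f g = (if g = h then 1 else 0)"
      using independent_linear_form[OF G, of "\<lambda>g. if g = h then 1 else 0"] by blast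
    have "contract f z = (\<Sum>g\<in>T. fscale (f g) (w g))"
      by (simp only: T(3) contract_sum[OF f(1)] contract_simps(5)[OF f(1)])
    also have "\<dots> = (\<Sum>g\<in>T. if h = g then w g else 0)"
    proof (rule sum.cong[OF refl])
      fix g assume "g \<in> T"
      then have "g \<in> G" using T(2) by blast
      then show "fscale (f g) (w g) = (if h = g then w g else 0)"
        by (cases "h = g") (simp_all add: f(2) fs.scale_zero_left)
    qed
    also have "\<dots> = w h" using that by (subst sum.delta'[OF T(1)]) (simp only: if_True)
    finally show ?thesis using contract_in[OF f(1) W(2) z(2)] by (simp only:)
  qed
  then show ?thesis unfolding T(3)
    using T(2) by (intro fs.subspace_sum[OF subspace_tensor_space] tensor_in_tensor_space)
      (auto intro: fs.span_base)
qed

section \<open>Cosets of subspaces\<close>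

lemma coset_eq:
  assumes N: "fs.subspace N" shows "u +o N = v +o N \<longleftrightarrow> u - v \<in> N"
proof
  assume "u +o N = v +o N"
  moreover have "u \<in> u +o N" using fs.subspace_0[OF N] by (force simp: elt_set_plus_def)
  ultimately show "u - v \<in> N" by (auto simp: set_minus_plus)
next
  assume d: "u - v \<in> N"
  have "u +o N = (v + (u - v)) +o N" by simp
  also have "\<dots> = v +o ((u - v) +o N)" by (simp only: set_plus_rearrange2)
  also have "(u - v) +o N = N"
  proof (intro equalityI subsetI)
    fix x assume "x \<in> (u - v) +o N"
    then show "x \<in> N" using fs.subspace_add[OF N d] by (auto simp: elt_set_plus_def)
  next
    fix x assume "x \<in> N"
    then have "x - (u - v) \<in> N" using fs.subspace_diff[OF N] d by blast
    then show "x \<in> (u - v) +o N" by (simp add: set_minus_plus)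
  qed
  finally show "u +o N = v +o N" .
qed

lemma coset_zero: "0 +o N = (N :: ('a \<Rightarrow> 'k::field) set)"
  by (auto simp: elt_set_plus_def)

lemma subspace_plus_self:
  assumes "fs.subspace N" shows "N + N = N"
  using fs.subspace_add[OF assms] fs.subspace_0[OF assms]
  by (force simp: set_plus_def)

lemma coset_plus: "fs.subspace N \<Longrightarrow> (u +o N) + (v +o N) = (u + v) +o N"
  by (simp add: set_plus_rearrange subspace_plus_self)

lemma coset_sum:
  assumes "fs.subspace N"
  shows "(\<Sum>t<(m::nat). z t +o N) + N = (\<Sum>t<m. z t) +o N"
proof (induction m)
  case 0
  show ?case by (simp only: lessThan_0 sum.empty set_zero set_add_0 coset_zero)
next
  case (Suc m)
  have "(\<Sum>t<Suc m. z t +o N) + N = ((\<Sum>t<m. z t +o N) + N) + (z m +o N)"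
    by (simp only: sum.lessThan_Suc add_ac)
  also have "\<dots> = ((\<Sum>t<m. z t) + z m) +o N"
    by (simp only: Suc coset_plus[OF assms])
  finally show ?case by (simp only: sum.lessThan_Suc)
qed

section \<open>Linear functionals on the free algebra\<close>

text \<open>The linear extension of a function on monomials; it serves for the free algebra and for its
  tensor square.\<close>

definition lsum :: "('b \<Rightarrow> 'k::field) \<Rightarrow> ('b \<Rightarrow>\<^sub>0 'k) \<Rightarrow> 'k" where
  "lsum \<phi> f = (\<Sum>m\<in>Poly_Mapping.keys f. Poly_Mapping.lookup f m * \<phi> m)"

lemma lsum_superset:
  assumes "finite A" "Poly_Mapping.keys f \<subseteq> A"
  shows "lsum \<phi> f = (\<Sum>m\<in>A. Poly_Mapping.lookup f m * \<phi> m)"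
  unfolding lsum_def using assms
  by (intro sum.mono_neutral_left) (auto simp: in_keys_iff)

lemma lsum_single [simp]: "lsum \<phi> (Poly_Mapping.single m c) = c * \<phi> m"
  by (simp add: lsum_def)

lemma lsum_zero [simp]: "lsum \<phi> 0 = 0"
  by (simp add: lsum_def)

lemma lsum_add [simp]: "lsum \<phi> (f + g) = lsum \<phi> f + lsum \<phi> g"
proof -
  let ?A = "Poly_Mapping.keys f \<union> Poly_Mapping.keys g"
  have "lsum \<phi> (f + g) = (\<Sum>m\<in>?A. Poly_Mapping.lookup (f + g) m * \<phi> m)"
    by (rule lsum_superset) (use Poly_Mapping.keys_add[of f g] in auto)
  moreover have "lsum \<phi> f = (\<Sum>m\<in>?A. Poly_Mapping.lookup f m * \<phi> m)"
    "lsum \<phi> g = (\<Sum>m\<in>?A. Poly_Mapping.lookup g m * \<phi> m)"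
    by (rule lsum_superset; auto)+
  ultimately show ?thesis by (simp add: lookup_add sum.distrib[symmetric] algebra_simps)
qed

lemma lsum_sum: "lsum \<phi> (\<Sum>x\<in>X. f x) = (\<Sum>x\<in>X. lsum \<phi> (f x))"
  by (induction X rule: infinite_finite_induct) auto

lemma sum_single_lookup: "(\<Sum>m\<in>Poly_Mapping.keys f. Poly_Mapping.single m (Poly_Mapping.lookup f m)) = f"
  by (rule poly_mapping_eqI) (simp add: lookup_sum lookup_single when_def in_keys_iff)

lemma fa_scale_single [simp]: "fa_scale c (Poly_Mapping.single m d) = Poly_Mapping.single m (c * d)"
  by (simp add: fa_scale_def mult_single)

lemma lsum_fa_scale [simp]: "lsum \<phi> (fa_scale c f) = c * lsum \<phi> f"
proof -
  let ?l = "Poly_Mapping.lookup f"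
  have "lsum \<phi> (fa_scale c f) =
      lsum \<phi> (fa_scale c (\<Sum>m\<in>Poly_Mapping.keys f. Poly_Mapping.single m (?l m)))"
    by (simp only: sum_single_lookup)
  also have "\<dots> = (\<Sum>m\<in>Poly_Mapping.keys f. c * (?l m * \<phi> m))"
    by (simp only: fa.scale_sum_right fa_scale_single lsum_sum lsum_single mult.assoc)
  also have "\<dots> = c * lsum \<phi> f"
    by (simp only: lsum_def sum_distrib_left)
  finally show ?thesis .
qed

lemma lsum_minus [simp]: "lsum \<phi> (f - g) = lsum \<phi> f - lsum \<phi> g"
  by (metis add_diff_cancel_right' diff_add_cancel lsum_add)

type_synonym word = "(nat \<times> nat) list"

text \<open>A linear functional on the free algebra is determined by its values on words.\<close>

definition lin_ext :: "(word \<Rightarrow> 'k::field) \<Rightarrow> 'k free_alg \<Rightarrow> 'k" where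
  "lin_ext \<phi> = lsum (\<lambda>m. \<phi> (letters m))"

definition on_word :: "('k free_alg \<Rightarrow> 'k::field) \<Rightarrow> word \<Rightarrow> 'k" where
  "on_word u w = u (Poly_Mapping.single (Mon w) 1)"

lemma on_word_lin_ext [simp]: "on_word (lin_ext \<phi>) = \<phi>"
  by (auto simp: on_word_def lin_ext_def)

lemma lin_ext_single [simp]: "lin_ext \<phi> (Poly_Mapping.single m c) = c * \<phi> (letters m)"
  by (simp add: lin_ext_def)

lemma lin_ext_eq_iff [simp]: "lin_ext \<phi> = lin_ext \<psi> \<longleftrightarrow> \<phi> = \<psi>"
  by (metis on_word_lin_ext)

lemma lin_ext_times:
  "lin_ext \<phi> (f * g) = (\<Sum>v\<in>Poly_Mapping.keys f. \<Sum>w\<in>Poly_Mapping.keys g.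
     Poly_Mapping.lookup f v * Poly_Mapping.lookup g w * \<phi> (letters v @ letters w))"
proof -
  have "f * g = (\<Sum>v\<in>Poly_Mapping.keys f. \<Sum>w\<in>Poly_Mapping.keys g.
     Poly_Mapping.single (v + w) (Poly_Mapping.lookup f v * Poly_Mapping.lookup g w))"
    by (simp only: sum_single_lookup sum_product[symmetric] mult_single[symmetric])
  then show ?thesis
    by (simp add: lin_ext_def lsum_sum plus_monomial_def)
qed

lemma lin_ext_linear: "Vector_Spaces.linear fa_scale (*) (lin_ext \<phi>)"
  by unfold_locales (simp_all add: lin_ext_def algebra_simps)

lemma linear_eq_lin_ext:
  assumes "Vector_Spaces.linear fa_scale (*) u"
  shows "u = lin_ext (on_word u)"
proof
  fix f
  interpret u: Vector_Spaces.linear fa_scale "(*)" u by fact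
  have "u f = u (\<Sum>m\<in>Poly_Mapping.keys f. fa_scale (Poly_Mapping.lookup f m) (Poly_Mapping.single m 1))"
    by (simp add: sum_single_lookup)
  also have "\<dots> = (\<Sum>m\<in>Poly_Mapping.keys f. Poly_Mapping.lookup f m * u (Poly_Mapping.single m 1))"
    by (simp only: u.sum u.scale)
  also have "\<dots> = lin_ext (on_word u) f"
    by (simp add: lin_ext_def lsum_def on_word_def)
  finally show "u f = lin_ext (on_word u) f" .
qed

lemma lin_ext_add: "lin_ext \<phi> + lin_ext \<psi> = lin_ext (\<lambda>w. \<phi> w + \<psi> w)"
  by (rule ext) (simp add: lin_ext_def lsum_def distrib_left sum.distrib)

lemma lin_ext_scale: "fscale c (lin_ext \<phi>) = lin_ext (\<lambda>w. c * \<phi> w)"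
  unfolding fscale_def lin_ext_def lsum_def sum_distrib_left
  by (intro ext sum.cong refl) (simp only: mult_ac)

lemma lin_ext_product:
  "lin_ext \<alpha> f * lin_ext \<beta> g = (\<Sum>v\<in>Poly_Mapping.keys f. \<Sum>w\<in>Poly_Mapping.keys g.
     Poly_Mapping.lookup f v * Poly_Mapping.lookup g w * (\<alpha> (letters v) * \<beta> (letters w)))"
  unfolding lin_ext_def lsum_def sum_product by (intro sum.cong refl) (simp only: mult_ac)

lemma coprod_lin_ext:
  assumes "\<And>v w. \<phi> (v @ w) = \<alpha> v * \<beta> w"
  shows "coprod (lin_ext \<phi>) = tensor (lin_ext \<alpha>) (lin_ext \<beta>)"
proof
  fix z :: "'a free_alg \<times> 'a free_alg"
  obtain f g where z: "z = (f, g)" by (cases z)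
  show "coprod (lin_ext \<phi>) z = tensor (lin_ext \<alpha>) (lin_ext \<beta>) z"
    by (simp only: z coprod_def tensor_def prod.case lin_ext_times assms lin_ext_product)
qed

text \<open>The pattern of a skew-primitive element.\<close>

lemma coprod_lin_ext2:
  assumes "\<And>v w. \<phi> (v @ w) = \<alpha> v * \<beta> w + \<gamma> v * \<delta> w"
  shows "coprod (lin_ext \<phi>) = tensor (lin_ext \<alpha>) (lin_ext \<beta>) + tensor (lin_ext \<gamma>) (lin_ext \<delta>)"
proof
  fix z :: "'a free_alg \<times> 'a free_alg"
  obtain f g where z: "z = (f, g)" by (cases z)
  show "coprod (lin_ext \<phi>) z = (tensor (lin_ext \<alpha>) (lin_ext \<beta>) + tensor (lin_ext \<gamma>) (lin_ext \<delta>)) z"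
    by (simp only: z coprod_def tensor_def prod.case plus_fun_apply lin_ext_times assms lin_ext_product
        distrib_left sum.distrib)
qed

section \<open>Convolution on words\<close>

text \<open>The coproduct of a word with lower indices \<open>i\<close> and upper indices \<open>j\<close> is the sum, over all rows \<open>k\<close> of
  intermediate indices, of the word from \<open>i\<close> to \<open>k\<close> tensor the word from \<open>k\<close> to \<open>j\<close>.\<close>

definition paths :: "nat \<Rightarrow> nat \<Rightarrow> nat list set" where
  "paths n m = {ks. set ks \<subseteq> {1..n} \<and> length ks = m}"

lemma finite_paths: "finite (paths n m)"
  unfolding paths_def by (rule finite_lists_length_eq) simp

definition word_conv :: "nat \<Rightarrow> (word \<Rightarrow> 'k) \<Rightarrow> (word \<Rightarrow> 'k) \<Rightarrow> word \<Rightarrow> 'k::field" where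
  "word_conv n \<phi> \<psi> w = (\<Sum>ks\<in>paths n (length w). \<phi> (zip (map fst w) ks) * \<psi> (zip ks (map snd w)))"

lemma Delta_mon_paths:
  "(Delta_mon n (Mon w) :: 'k::field free_alg2) =
     (\<Sum>ks\<in>paths n (length w). Poly_Mapping.single (Mon (zip (map fst w) ks), Mon (zip ks (map snd w))) 1)"
proof (induction w)
  case Nil
  have "paths n 0 = {[]}" by (auto simp: paths_def)
  moreover have "Poly_Mapping.single (Mon [], Mon []) (1::'k) = 1"
    by (simp flip: zero_monomial_def zero_prod_def)
  ultimately show ?case by (simp add: Delta_mon_def)
next
  case (Cons x w)
  obtain i j where x: "x = (i, j)" by (cases x)
  have P: "paths n (length (x # w)) = (\<lambda>(ks, k). k # ks) ` (paths n (length w) \<times> {1..n})"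
    unfolding paths_def length_Cons by (rule lists_length_Suc_eq)
  have inj: "inj_on (\<lambda>(ks, k). k # ks) (paths n (length w) \<times> {1..n})"
    by (auto simp: inj_on_def)
  have "(Delta_mon n (Mon (x # w)) :: 'k free_alg2) =
      (\<Sum>k=1..n. Poly_Mapping.single (Mon [(i, k)], Mon [(k, j)]) 1) * Delta_mon n (Mon w)"
    by (simp add: Delta_mon_def x)
  also have "\<dots> = (\<Sum>k=1..n. \<Sum>ks\<in>paths n (length w).
      Poly_Mapping.single (Mon ((i, k) # zip (map fst w) ks), Mon ((k, j) # zip ks (map snd w))) 1)"
    by (simp only: Cons sum_product mult_single add_Pair plus_monomial_def monomial.sel append.simps mult_1)
  also have "\<dots> = (\<Sum>ks\<in>paths n (length w). \<Sum>k=1..n.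
      Poly_Mapping.single (Mon ((i, k) # zip (map fst w) ks), Mon ((k, j) # zip ks (map snd w))) 1)"
    by (rule sum.swap)
  also have "\<dots> = (\<Sum>ks\<in>paths n (length (x # w)).
      Poly_Mapping.single (Mon (zip (map fst (x # w)) ks), Mon (zip ks (map snd (x # w)))) 1)"
    unfolding P sum.reindex[OF inj] sum.cartesian_product
    by (intro sum.cong refl) (simp add: x case_prod_unfold)
  finally show ?case .
qed

lemma convol_eq_lin_ext: "convol n u v = lin_ext (word_conv n (on_word u) (on_word v))"
proof
  fix f :: "'a free_alg"
  let ?\<psi> = "\<lambda>(a, b). u (Poly_Mapping.single a 1) * v (Poly_Mapping.single b 1)"
  have "convol n u v f = lsum ?\<psi> (Delta n f)"
    unfolding convol_def lsum_def by (rule sum.cong) auto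
  also have "\<dots> = (\<Sum>m\<in>Poly_Mapping.keys f. Poly_Mapping.lookup f m * lsum ?\<psi> (Delta_mon n m))"
    by (simp add: Delta_def lsum_sum)
  also have "\<dots> = (\<Sum>m\<in>Poly_Mapping.keys f. Poly_Mapping.lookup f m *
      word_conv n (on_word u) (on_word v) (letters m))"
  proof (rule sum.cong[OF refl])
    fix m :: monomial
    obtain w where m: "m = Mon w" by (cases m)
    show "Poly_Mapping.lookup f m * lsum ?\<psi> (Delta_mon n m) =
        Poly_Mapping.lookup f m * word_conv n (on_word u) (on_word v) (letters m)"
      by (simp add: m Delta_mon_paths lsum_sum word_conv_def on_word_def)
  qed
  finally show "convol n u v f = lin_ext (word_conv n (on_word u) (on_word v)) f"
    by (simp add: lin_ext_def lsum_def)
qed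

lemma convol_lin_ext: "convol n (lin_ext \<phi>) (lin_ext \<psi>) = lin_ext (word_conv n \<phi> \<psi>)"
  by (simp add: convol_eq_lin_ext)

section \<open>Diagonal characters\<close>

text \<open>The value at a word of the character \<open>T_i^j \<mapsto> \<delta>\<^sub>i\<^sub>j t\<^sub>i\<close>. Letters with an index outside \<open>{1..n}\<close> are zero
  in the FRT algebra, and the character vanishes on them.\<close>

definition diag_word :: "nat \<Rightarrow> (nat \<Rightarrow> 'k) \<Rightarrow> word \<Rightarrow> 'k::field" where
  "diag_word n t w = (\<Prod>(i, j)\<leftarrow>w. if i = j \<and> i \<in> {1..n} then t i else 0)"

definition diag_char :: "nat \<Rightarrow> (nat \<Rightarrow> 'k) \<Rightarrow> 'k free_alg \<Rightarrow> 'k::field" where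
  "diag_char n t = lin_ext (diag_word n t)"

definition weight :: "nat \<Rightarrow> (nat \<Rightarrow> 'k) \<Rightarrow> nat list \<Rightarrow> 'k::field" where
  "weight n t is = (\<Prod>i\<leftarrow>is. if i \<in> {1..n} then t i else 0)"

lemma diag_word_simps [simp]:
  "diag_word n t [] = 1"
  "diag_word n t ((i, j) # w) = (if i = j \<and> i \<in> {1..n} then t i else 0) * diag_word n t w"
  "diag_word n t (v @ w) = diag_word n t v * diag_word n t w"
  by (simp_all add: diag_word_def)

lemma weight_simps [simp]:
  "weight n t [] = 1"
  "weight n t (i # is) = (if i \<in> {1..n} then t i else 0) * weight n t is"
  "weight n t (is @ js) = weight n t is * weight n t js"
  by (simp_all add: weight_def)

lemma diag_word_cong: "(\<And>i. i \<in> {1..n} \<Longrightarrow> s i = t i) \<Longrightarrow> diag_word n s = diag_word n t"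
  unfolding diag_word_def fun_eq_iff by (intro allI arg_cong[where f = prod_list] map_cong) auto

lemma diag_char_cong: "(\<And>i. i \<in> {1..n} \<Longrightarrow> s i = t i) \<Longrightarrow> diag_char n s = diag_char n t"
  unfolding diag_char_def by (metis diag_word_cong)

lemma weight_outside: "\<not> set is \<subseteq> {1..n} \<Longrightarrow> weight n t is = 0"
  by (induction "is") auto

lemma weight_mult: "weight n s is * weight n t is = weight n (\<lambda>i. s i * t i) is"
  by (induction "is") auto

lemma weight_one: "weight n (\<lambda>i. 1) is = (if set is \<subseteq> {1..n} then 1 else 0)"
  by (induction "is") auto

lemma diag_word_zip:
  "length is = length ks \<Longrightarrow> diag_word n t (zip is ks) = (if is = ks then weight n t is else 0)"
  by (induction "is" ks rule: list_induct2) auto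

lemma diag_word_eq: "diag_word n t w = (if map fst w = map snd w then weight n t (map fst w) else 0)"
  using diag_word_zip[of "map fst w" "map snd w" n t] by (simp add: zip_map_fst_snd)

text \<open>A diagonal character sees only the row of intermediate indices that repeats the lower indices of
  the word. Convolution with it therefore rescales each word separately: by the weight of the lower
  indices from the left, and by that of the upper indices from the right. All computations with
  group-like elements reduce to this.\<close>

lemma word_conv_diag_left: "word_conv n (diag_word n t) \<psi> w = weight n t (map fst w) * \<psi> w"
proof (cases "set (map fst w) \<subseteq> {1..n}")
  case True
  then have mem: "map fst w \<in> paths n (length w)" by (simp add: paths_def)
  have "word_conv n (diag_word n t) \<psi> w =
      (\<Sum>ks\<in>paths n (length w). if map fst w = ks then weight n t ks * \<psi> (zip ks (map snd w)) else 0)"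
    unfolding word_conv_def by (intro sum.cong refl) (auto simp: diag_word_zip paths_def)
  also have "\<dots> = weight n t (map fst w) * \<psi> (zip (map fst w) (map snd w))"
    using mem by (subst sum.delta'[OF finite_paths]) simp
  finally show ?thesis by (simp add: zip_map_fst_snd)
next
  case False
  have "diag_word n t (zip (map fst w) ks) = 0" if "ks \<in> paths n (length w)" for ks
    using that weight_outside[OF False]
    by (cases "map fst w = ks") (simp_all only: diag_word_zip paths_def mem_Collect_eq length_map if_False if_True refl)
  then show ?thesis by (simp add: word_conv_def weight_outside[OF False])
qed

lemma word_conv_diag_right: "word_conv n \<psi> (diag_word n t) w = weight n t (map snd w) * \<psi> w"
proof (cases "set (map snd w) \<subseteq> {1..n}")
  case True
  then have mem: "map snd w \<in> paths n (length w)" by (simp add: paths_def)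
  have "word_conv n \<psi> (diag_word n t) w =
      (\<Sum>ks\<in>paths n (length w). if map snd w = ks then weight n t ks * \<psi> (zip (map fst w) ks) else 0)"
    unfolding word_conv_def by (intro sum.cong refl) (auto simp: diag_word_zip paths_def)
  also have "\<dots> = weight n t (map snd w) * \<psi> (zip (map fst w) (map snd w))"
    using mem by (subst sum.delta'[OF finite_paths]) simp
  finally show ?thesis by (simp add: zip_map_fst_snd)
next
  case False
  have "diag_word n t (zip ks (map snd w)) = 0" if "ks \<in> paths n (length w)" for ks
    using that weight_outside[OF False]
    by (cases "ks = map snd w") (simp_all only: diag_word_zip paths_def mem_Collect_eq length_map if_False if_True refl)
  then show ?thesis by (simp add: word_conv_def weight_outside[OF False])
qed

lemma convol_diag_left:
  "convol n (diag_char n t) (lin_ext \<psi>) = lin_ext (\<lambda>w. weight n t (map fst w) * \<psi> w)"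
  unfolding diag_char_def convol_lin_ext lin_ext_eq_iff by (rule ext) (rule word_conv_diag_left)

lemma convol_diag_right:
  "convol n (lin_ext \<psi>) (diag_char n t) = lin_ext (\<lambda>w. weight n t (map snd w) * \<psi> w)"
  unfolding diag_char_def convol_lin_ext lin_ext_eq_iff by (rule ext) (rule word_conv_diag_right)

lemma convol_diag_diag:
  "convol n (diag_char n s) (diag_char n t) = diag_char n (\<lambda>i. s i * t i)"
  unfolding diag_char_def[of n t] convol_diag_left unfolding diag_char_def lin_ext_eq_iff
  by (rule ext) (simp add: diag_word_eq weight_mult)

lemma char_of_eq: "char_of t = lin_ext (\<lambda>w. \<Prod>(i, j)\<leftarrow>w. t i j)"
  by (simp add: fun_eq_iff char_of_def lin_ext_def lsum_def)

lemma counit_eq: "counit n = diag_char n (\<lambda>i. 1)"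
  unfolding counit_def char_of_eq diag_char_def diag_word_def by simp

lemma K_eq: "K n r p i = diag_char n (kappa r p i)"
  unfolding K_def char_of_eq diag_char_def diag_word_def
  by (rule arg_cong[where f = lin_ext], intro ext arg_cong[where f = prod_list] map_cong) auto

lemma diag_char_times: "diag_char n t (f * g) = diag_char n t f * diag_char n t g"
proof -
  have "coprod (diag_char n t) = tensor (diag_char n t) (diag_char n t)"
    unfolding diag_char_def by (rule coprod_lin_ext) simp
  then show ?thesis by (simp add: fun_eq_iff coprod_def tensor_def)
qed

lemma coprod_diag_char: "coprod (diag_char n t) = tensor (diag_char n t) (diag_char n t)"
  by (auto simp: fun_eq_iff coprod_def tensor_def diag_char_times)

lemma diag_char_simps [simp]:
  "diag_char n t (f + g) = diag_char n t f + diag_char n t g"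
  "diag_char n t (f - g) = diag_char n t f - diag_char n t g"
  "diag_char n t (fa_scale c f) = c * diag_char n t f"
  "diag_char n t 0 = 0"
  "diag_char n t 1 = 1"
proof -
  have "(1 :: 'a free_alg) = Poly_Mapping.single (Mon []) 1"
    by (simp flip: zero_monomial_def)
  then have "diag_char n t 1 = diag_char n t (Poly_Mapping.single (Mon []) 1)" by (simp only:)
  then show "diag_char n t 1 = 1" by (simp add: diag_char_def)
qed (simp_all add: diag_char_def lin_ext_def)

lemma diag_char_sum: "diag_char n t (\<Sum>x\<in>X. f x) = (\<Sum>x\<in>X. diag_char n t (f x))"
  by (induction X rule: infinite_finite_induct) auto

lemma diag_char_T_gen: "diag_char n t (T_gen i j) = (if i = j \<and> i \<in> {1..n} then t i else 0)"
  by (simp add: diag_char_def)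

text \<open>A coefficient \<open>R_{ij}^{ab}\<close> vanishes unless \<open>{a, b} = {i, j}\<close>, so both sides of an FRT relation take the
  value \<open>R_{ij}^{ab} t\<^sub>i t\<^sub>j\<close>.\<close>

lemma frt_ideal_subset_kernel:
  fixes r :: "'k::field"
  shows "frt_ideal n r p \<subseteq> {f. diag_char n t f = 0}"
proof -
  let ?J = "{f :: 'k free_alg. diag_char n t f = 0}"
  have rel: "diag_char n t (frt_relator n r p i j a b) = 0" if "{i, j, a, b} \<subseteq> {1..n}" for i j a b
  proof -
    have "diag_char n t (frt_relator n r p i j a b) =
        (\<Sum>k=1..n. \<Sum>l=1..n. R_coeff r p i j k l * (diag_char n t (T_gen k a) * diag_char n t (T_gen l b)))
        - (\<Sum>k=1..n. \<Sum>l=1..n. R_coeff r p k l a b * (diag_char n t (T_gen i k) * diag_char n t (T_gen j l)))"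
      by (simp only: frt_relator_def diag_char_simps diag_char_sum diag_char_times)
    also have "(\<Sum>k=1..n. \<Sum>l=1..n. R_coeff r p i j k l * (diag_char n t (T_gen k a) * diag_char n t (T_gen l b)))
        = (\<Sum>k=1..n. \<Sum>l=1..n. if k = a then if l = b then R_coeff r p i j a b * (t a * t b) else 0 else 0)"
      using that by (intro sum.cong refl) (auto simp: diag_char_T_gen)
    also have "\<dots> = (\<Sum>k=1..n. if k = a then R_coeff r p i j a b * (t a * t b) else 0)"
      using that by (intro sum.cong refl) auto
    also have "\<dots> = R_coeff r p i j a b * (t a * t b)"
      using that by simp
    also have "(\<Sum>k=1..n. \<Sum>l=1..n. R_coeff r p k l a b * (diag_char n t (T_gen i k) * diag_char n t (T_gen j l)))
        = (\<Sum>k=1..n. \<Sum>l=1..n. if k = i then if l = j then R_coeff r p i j a b * (t i * t j) else 0 else 0)"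
      using that by (intro sum.cong refl) (auto simp: diag_char_T_gen)
    also have "\<dots> = (\<Sum>k=1..n. if k = i then R_coeff r p i j a b * (t i * t j) else 0)"
      using that by (intro sum.cong refl) auto
    also have "\<dots> = R_coeff r p i j a b * (t i * t j)"
      using that by simp
    also have "R_coeff r p i j a b * (t a * t b) - R_coeff r p i j a b * (t i * t j) = 0"
      by (auto simp: R_coeff_def)
    finally show ?thesis .
  qed
  have "two_sided_ideal ?J"
    by (simp add: two_sided_ideal_def diag_char_times)
  moreover have "{frt_relator n r p i j a b | i j a b. {i, j, a, b} \<subseteq> {1..n}} \<subseteq> ?J"
    using rel by blast
  moreover have "{T_gen i j | i j. \<not> {i, j} \<subseteq> {1..n}} \<subseteq> ?J"
    by (auto simp: diag_char_T_gen)
  ultimately show ?thesis unfolding frt_ideal_def by (intro Inter_lower CollectI) blast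
qed

lemma diag_char_in_finite_dual: "diag_char n t \<in> finite_dual n r p"
proof -
  let ?J = "{f. diag_char n t f = 0}"
  have "f \<in> fa.span ({1} \<union> ?J)" for f
  proof -
    have "f = (f - fa_scale (diag_char n t f) 1) + fa_scale (diag_char n t f) 1" by simp
    moreover have "f - fa_scale (diag_char n t f) 1 \<in> ?J" by simp
    ultimately show ?thesis
      by (metis (no_types, lifting) UnCI fa.span_add fa.span_base fa.span_scale singletonI)
  qed
  then have "finite_codim ?J"
    unfolding finite_codim_def by (intro exI[of _ "{1}"]) auto
  moreover have "two_sided_ideal ?J"
    by (simp add: two_sided_ideal_def diag_char_times)
  ultimately show ?thesis
    using frt_ideal_subset_kernel[of n r p t] lin_ext_linear[of "diag_word n t"]
    unfolding finite_dual_def diag_char_def[symmetric] by blast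
qed

lemma on_word_outside:
  assumes u: "u \<in> finite_dual n r p" and w: "\<not> set (map fst w) \<subseteq> {1..n}"
  shows "on_word u w = 0"
proof -
  obtain J where J: "two_sided_ideal J" "frt_ideal n r p \<subseteq> J" "\<And>x. x \<in> J \<Longrightarrow> u x = 0"
    using u unfolding finite_dual_def by blast
  obtain v i j v' where v: "w = v @ (i, j) # v'" "i \<notin> {1..n}"
  proof -
    from w obtain x where x: "x \<in> set w" "fst x \<notin> {1..n}" unfolding set_map by blast
    then obtain v v' where "w = v @ x # v'" by (auto dest: split_list)
    with x that[of v "fst x" "snd x" v'] show thesis by simp
  qed
  have "T_gen i j \<in> frt_ideal n r p"
    unfolding frt_ideal_def using v(2) by blast
  then have "Poly_Mapping.single (Mon v) 1 * T_gen i j * Poly_Mapping.single (Mon v') 1 \<in> J"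
    using J unfolding two_sided_ideal_def by blast
  then show ?thesis using J(3)
    by (simp add: mult_single plus_monomial_def on_word_def v(1))
qed

text \<open>The inverse is defined by a unique description in the finite dual. A right inverse is determined on
  words whose lower indices lie in range, because there the convolution is multiplication by a nonzero
  weight; on all other words every element of the finite dual vanishes.\<close>

lemma inv_diag_char:
  assumes t: "\<And>i. i \<in> {1..n} \<Longrightarrow> t i \<noteq> 0"
  shows "inv\<^bsub>dual_monoid n r p\<^esub> (diag_char n t) = diag_char n (\<lambda>i. inverse (t i))"
proof -
  have c: "diag_char n (\<lambda>i. inverse (t i) * t i) = counit n" "diag_char n (\<lambda>i. t i * inverse (t i)) = counit n"
    unfolding counit_eq using t by (auto intro!: diag_char_cong)
  show ?thesis unfolding m_inv_def
  proof (rule the_equality)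
    show "diag_char n (\<lambda>i. inverse (t i)) \<in> carrier (dual_monoid n r p) \<and>
        diag_char n t \<otimes>\<^bsub>dual_monoid n r p\<^esub> diag_char n (\<lambda>i. inverse (t i)) = \<one>\<^bsub>dual_monoid n r p\<^esub> \<and>
        diag_char n (\<lambda>i. inverse (t i)) \<otimes>\<^bsub>dual_monoid n r p\<^esub> diag_char n t = \<one>\<^bsub>dual_monoid n r p\<^esub>"
      by (simp add: dual_monoid_def diag_char_in_finite_dual convol_diag_diag c)
  next
    fix y assume y: "y \<in> carrier (dual_monoid n r p) \<and>
        diag_char n t \<otimes>\<^bsub>dual_monoid n r p\<^esub> y = \<one>\<^bsub>dual_monoid n r p\<^esub> \<and>
        y \<otimes>\<^bsub>dual_monoid n r p\<^esub> diag_char n t = \<one>\<^bsub>dual_monoid n r p\<^esub>"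
    then have yd: "y \<in> finite_dual n r p" and ty: "convol n (diag_char n t) y = counit n"
      by (auto simp: dual_monoid_def)
    obtain \<psi> where \<psi>: "y = lin_ext \<psi>"
      using yd linear_eq_lin_ext unfolding finite_dual_def by blast
    have eq: "weight n t (map fst w) * \<psi> w = diag_word n (\<lambda>i. 1) w" for w
      using ty unfolding \<psi> convol_diag_left counit_eq unfolding diag_char_def lin_ext_eq_iff by (rule fun_cong)
    have "\<psi> w = diag_word n (\<lambda>i. inverse (t i)) w" for w
    proof (cases "set (map fst w) \<subseteq> {1..n}")
      case True
      let ?t' = "\<lambda>i. inverse (t i)"
      have "weight n (\<lambda>i. inverse (t i) * t i) (map fst w) = weight n (\<lambda>i. 1) (map fst w)"
        unfolding weight_def using t by (intro arg_cong[where f = prod_list] map_cong) auto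
      then have "weight n ?t' (map fst w) * weight n t (map fst w) = 1"
        unfolding weight_mult weight_one using True by simp
      then have "\<psi> w = weight n ?t' (map fst w) * (weight n t (map fst w) * \<psi> w)"
        by (simp add: mult.assoc[symmetric])
      also have "\<dots> = diag_word n ?t' w"
        unfolding eq by (simp add: diag_word_eq weight_mult)
      finally show ?thesis .
    next
      case False
      then have "\<psi> w = 0" using on_word_outside[OF yd False] by (simp add: \<psi>)
      then show ?thesis by (simp only: diag_word_eq weight_outside[OF False] if_cancel)
    qed
    then show "y = diag_char n (\<lambda>i. inverse (t i))"
      unfolding \<psi> diag_char_def lin_ext_eq_iff by (rule ext)
  qed
qed

(* Diagonal words are recognised by the equality of their two rows of indices. *)
declare map_eq_conv [simp del]

section \<open>Linear combinations of characters\<close>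

text \<open>Artin's proof of the independence of characters, in a form that also locates the characters: for
  \<open>u\<close> a combination of characters, \<open>u(\<cdot> y) - g(y) u\<close> is again one, with \<open>g\<close> removed and with every \<open>h\<close>
  such that \<open>h(y) \<noteq> g(y)\<close> kept.\<close>

lemma translation_closed_contains_characters:
  fixes S :: "('a::times \<Rightarrow> 'k::field) set"
  assumes S: "fs.subspace S" "\<And>u b. u \<in> S \<Longrightarrow> (\<lambda>a. u (a * b)) \<in> S"
    and "finite T" "\<And>g a b. g \<in> T \<Longrightarrow> g (a * b) = g a * g b"
    and "\<And>g. g \<in> T \<Longrightarrow> c g \<noteq> 0" "(\<Sum>g\<in>T. fscale (c g) g) \<in> S"
  shows "T \<subseteq> S"
  using assms(3-)
proof (induction T arbitrary: c rule: finite_psubset_induct)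
  case (psubset T)
  show ?case
  proof
    fix h assume h: "h \<in> T"
    show "h \<in> S"
    proof (cases "T = {h}")
      case True
      then have "fscale (c h) h \<in> S" using psubset.prems(3) by (simp only: sum.insert sum.empty finite.emptyI empty_iff not_False_eq_True add_0_right)
      then have "fscale (inverse (c h)) (fscale (c h) h) \<in> S" by (rule fs.subspace_scale[OF S(1)])
      then show ?thesis using psubset.prems(2)[OF h] by (simp add: fscale_def)
    next
      case False
      then obtain g where g: "g \<in> T" "g \<noteq> h" using h by blast
      then obtain y where y: "h y \<noteq> g y" by (metis ext)
      let ?x = "\<Sum>t\<in>T. fscale (c t) t"
      let ?c = "\<lambda>t. c t * (t y - g y)"
      let ?T' = "{t \<in> T. t y \<noteq> g y}"
      have ev: "(\<Sum>t\<in>X. f t) a = (\<Sum>t\<in>X. f t a)" for X :: "('a \<Rightarrow> 'k) set" and f :: "('a \<Rightarrow> 'k) \<Rightarrow> 'a \<Rightarrow> 'k" and a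
        by (induction X rule: infinite_finite_induct) (simp_all only: sum.infinite sum.empty sum.insert not_False_eq_True plus_fun_apply zero_fun_apply)
      have "(\<lambda>a. ?x (a * y)) - fscale (g y) ?x = (\<Sum>t\<in>?T'. fscale (?c t) t)"
      proof
        fix a
        have "((\<lambda>a. ?x (a * y)) - fscale (g y) ?x) a = (\<Sum>t\<in>T. c t * t (a * y)) - g y * (\<Sum>t\<in>T. c t * t a)"
          by (simp only: minus_apply ev fscale_def)
        also have "\<dots> = (\<Sum>t\<in>T. ?c t * t a)"
          unfolding sum_distrib_left sum_subtractf[symmetric]
        proof (intro sum.cong refl)
          fix t assume "t \<in> T"
          then have "t (a * y) = t a * t y" by (rule psubset.prems(1))
          then show "c t * t (a * y) - g y * (c t * t a) = ?c t * t a" by (simp only: algebra_simps)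
        qed
        also have "\<dots> = (\<Sum>t\<in>?T'. ?c t * t a)"
          using psubset.hyps by (intro sum.mono_neutral_right) auto
        finally show "((\<lambda>a. ?x (a * y)) - fscale (g y) ?x) a = (\<Sum>t\<in>?T'. fscale (?c t) t) a"
          by (simp only: ev fscale_def)
      qed
      moreover have "(\<lambda>a. ?x (a * y)) - fscale (g y) ?x \<in> S"
        using S psubset.prems(3) by (intro fs.subspace_diff fs.subspace_scale) auto
      ultimately have "(\<Sum>t\<in>?T'. fscale (?c t) t) \<in> S" by (simp only:)
      moreover have "?T' \<subset> T" using g by blast
      ultimately have "?T' \<subseteq> S"
        using psubset.prems(1,2) by (intro psubset.IH[where c = ?c]) auto
      with h y show ?thesis by blast
    qed
  qed
qed

lemma independent_characters:
  fixes G :: "('a::times \<Rightarrow> 'k::field) set"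
  assumes mult: "\<And>g a b. g \<in> G \<Longrightarrow> g (a * b) = g a * g b" and nz: "0 \<notin> G"
  shows "fs.independent G"
proof
  assume "fs.dependent G"
  then obtain T c where T: "finite T" "T \<subseteq> G" "(\<Sum>v\<in>T. fscale (c v) v) = 0" "\<exists>v\<in>T. c v \<noteq> 0"
    unfolding fs.dependent_explicit by blast
  let ?T = "{v \<in> T. c v \<noteq> 0}"
  have "(\<Sum>v\<in>?T. fscale (c v) v) = (\<Sum>v\<in>T. fscale (c v) v)"
    using T(1) by (intro sum.mono_neutral_left) (auto simp: fscale_def fun_eq_iff)
  then have "(\<Sum>v\<in>?T. fscale (c v) v) \<in> {0}" by (simp only: T(3) singleton_iff)
  moreover have "(\<lambda>a. u (a * b)) \<in> {0}" if "u \<in> {0}" for u :: "'a \<Rightarrow> 'k" and b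
    using that by (simp add: fun_eq_iff)
  ultimately have "?T \<subseteq> {0}"
    using T(1,2) mult
    by (intro translation_closed_contains_characters[where c = c]) (auto simp: fs.subspace_single_0)
  with T(2,4) nz show False by blast
qed

section \<open>Triangularity and degree\<close>

lemma on_word_simps:
  "on_word (u + v) = (\<lambda>w. on_word u w + on_word v w)"
  "on_word (fscale c u) = (\<lambda>w. c * on_word u w)"
  by (rule ext, simp add: on_word_def fscale_def)+

lemma word_conv_linear:
  "word_conv n (\<lambda>w. \<phi> w + \<phi>' w) \<psi> = (\<lambda>w. word_conv n \<phi> \<psi> w + word_conv n \<phi>' \<psi> w)"
  "word_conv n \<phi> (\<lambda>w. \<psi> w + \<psi>' w) = (\<lambda>w. word_conv n \<phi> \<psi> w + word_conv n \<phi> \<psi>' w)"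
  "word_conv n (\<lambda>w. c * \<phi> w) \<psi> = (\<lambda>w. c * word_conv n \<phi> \<psi> w)"
  "word_conv n \<phi> (\<lambda>w. c * \<psi> w) = (\<lambda>w. c * word_conv n \<phi> \<psi> w)"
  unfolding word_conv_def distrib_left distrib_right sum.distrib sum_distrib_left
  by (simp_all only: mult_ac)

lemma convol_linear:
  "convol n (u + u') v = convol n u v + convol n u' v"
  "convol n u (v + v') = convol n u v + convol n u v'"
  "convol n (fscale c u) v = fscale c (convol n u v)"
  "convol n u (fscale c v) = fscale c (convol n u v)"
  by (simp_all only: convol_eq_lin_ext lin_ext_add lin_ext_scale on_word_simps word_conv_linear)

lemma convol_zero: "convol n 0 v = 0" "convol n u 0 = 0"
  using convol_linear(3)[of n 0 0 v] convol_linear(4)[of n u 0 0]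
  by (simp_all add: fs.scale_zero_left)

lemma convol_span:
  assumes "\<And>u v. u \<in> X \<Longrightarrow> v \<in> Y \<Longrightarrow> convol n u v \<in> S" "fs.subspace S"
    and "u \<in> fs.span X" "v \<in> fs.span Y"
  shows "convol n u v \<in> S"
proof -
  have "fs.span X \<subseteq> {u. convol n u y \<in> S}" if "y \<in> Y" for y
    using assms(1,2) that
    by (intro fs.span_minimal) (auto simp: fs.subspace_def convol_linear convol_zero)
  then have "fs.span Y \<subseteq> {v. convol n u v \<in> S}"
    using assms(2,3)
    by (intro fs.span_minimal) (auto simp: fs.subspace_def convol_linear convol_zero)
  with assms(4) show ?thesis by blast
qed

text \<open>All functionals in the algebra generated by the \<open>K\<close> and the \<open>E\<close> vanish on words containing a letter
  \<open>T_i^j\<close> with \<open>i > j\<close>. On the remaining words the degree, in which \<open>T_i^j\<close> counts \<open>j - i\<close>, is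
  nonnegative, and it is zero exactly on words of diagonal letters.\<close>

definition upper :: "(word \<Rightarrow> 'k::field) \<Rightarrow> bool" where
  "upper \<phi> \<longleftrightarrow> (\<forall>w. \<phi> w \<noteq> 0 \<longrightarrow> list_all2 (\<le>) (map fst w) (map snd w))"

definition deg :: "word \<Rightarrow> int" where
  "deg w = int (sum_list (map snd w)) - int (sum_list (map fst w))"

definition bounded_by :: "nat \<Rightarrow> (word \<Rightarrow> 'k::field) \<Rightarrow> bool" where
  "bounded_by m \<phi> \<longleftrightarrow> (\<forall>w. deg w > int m \<longrightarrow> \<phi> w = 0)"

definition diag_part :: "(word \<Rightarrow> 'k) \<Rightarrow> word \<Rightarrow> 'k::field" where
  "diag_part \<phi> w = (if map fst w = map snd w then \<phi> w else 0)"

lemma upper_word_conv: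
  assumes "upper \<phi>" "upper \<psi>"
  shows "upper (word_conv n \<phi> \<psi>)"
  unfolding upper_def
proof (intro allI impI)
  fix w assume "word_conv n \<phi> \<psi> w \<noteq> 0"
  then obtain ks where ks: "length ks = length w" "\<phi> (zip (map fst w) ks) \<noteq> 0" "\<psi> (zip ks (map snd w)) \<noteq> 0"
    unfolding word_conv_def by (auto simp: paths_def elim!: sum.not_neutral_contains_not_neutral)
  have "list_all2 (\<le>) (map fst w) ks" "list_all2 (\<le>) ks (map snd w)"
    using assms ks unfolding upper_def by fastforce+
  then show "list_all2 (\<le>) (map fst w) (map snd w)"
    by (rule list_all2_trans[rotated]) auto
qed

lemma bounded_word_conv:
  assumes "bounded_by a \<phi>" "bounded_by b \<psi>"
  shows "bounded_by (a + b) (word_conv n \<phi> \<psi>)"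
  unfolding bounded_by_def
proof (intro allI impI, rule ccontr)
  fix w assume w: "int (a + b) < deg w" and "word_conv n \<phi> \<psi> w \<noteq> 0"
  then obtain ks where ks: "length ks = length w" "\<phi> (zip (map fst w) ks) \<noteq> 0" "\<psi> (zip ks (map snd w)) \<noteq> 0"
    unfolding word_conv_def by (auto simp: paths_def elim!: sum.not_neutral_contains_not_neutral)
  have "deg (zip (map fst w) ks) \<le> int a" "deg (zip ks (map snd w)) \<le> int b"
    using assms ks unfolding bounded_by_def by force+
  with w ks(1) show False by (simp add: deg_def)
qed

text \<open>Between two equal rows of indices an upper triangular functional allows only the constant path, as
  \<open>i \<le> k \<le> i\<close> in every letter. So taking the diagonal part respects convolution.\<close>

lemma diag_part_word_conv:
  assumes "upper \<phi>" "upper \<psi>"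
  shows "diag_part (word_conv n \<phi> \<psi>) = word_conv n (diag_part \<phi>) (diag_part \<psi>)"
proof
  fix w
  show "diag_part (word_conv n \<phi> \<psi>) w = word_conv n (diag_part \<phi>) (diag_part \<psi>) w"
  proof (cases "map fst w = map snd w")
    case True
    have "word_conv n \<phi> \<psi> w = word_conv n (diag_part \<phi>) (diag_part \<psi>) w"
      unfolding word_conv_def
    proof (intro sum.cong refl)
      fix ks assume ks: "ks \<in> paths n (length w)"
      show "\<phi> (zip (map fst w) ks) * \<psi> (zip ks (map snd w)) =
          diag_part \<phi> (zip (map fst w) ks) * diag_part \<psi> (zip ks (map snd w))"
      proof (cases "ks = map fst w")
        case True
        then show ?thesis using ks \<open>map fst w = map snd w\<close> by (simp add: diag_part_def paths_def)
      next
        case False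
        have "\<phi> (zip (map fst w) ks) = 0 \<or> \<psi> (zip ks (map snd w)) = 0"
        proof (rule ccontr)
          assume "\<not> ?thesis"
          then have "list_all2 (\<le>) (map fst w) ks" "list_all2 (\<le>) ks (map fst w)"
            using assms ks True unfolding upper_def paths_def by fastforce+
          then have "map fst w = ks" by (intro list_all2_antisym[of "(\<le>)" "(\<le>)"]) auto
          with False show False by simp
        qed
        with False ks show ?thesis by (auto simp: diag_part_def paths_def)
      qed
    qed
    with True show ?thesis by (simp add: diag_part_def)
  next
    case False
    have "diag_part \<phi> (zip (map fst w) ks) * diag_part \<psi> (zip ks (map snd w)) = 0"
      if "ks \<in> paths n (length w)" for ks
      using that False by (auto simp: diag_part_def paths_def)
    then have "word_conv n (diag_part \<phi>) (diag_part \<psi>) w = 0"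
      unfolding word_conv_def by (intro sum.neutral ballI)
    then show ?thesis using False by (simp add: diag_part_def[of _ w])
  qed
qed

lemma list_all2_le_sum_eq:
  fixes xs ys :: "nat list"
  assumes "list_all2 (\<le>) xs ys" "sum_list ys \<le> sum_list xs"
  shows "xs = ys"
proof -
  have "sum_list xs \<le> sum_list ys \<and> (sum_list ys \<le> sum_list xs \<longrightarrow> xs = ys)"
    using assms(1) by (induction rule: list_all2_induct) auto
  with assms(2) show ?thesis by blast
qed

lemma diag_part_self:
  assumes "upper \<phi>" "bounded_by 0 \<phi>"
  shows "diag_part \<phi> = \<phi>"
proof
  fix w
  show "diag_part \<phi> w = \<phi> w"
  proof (cases "\<phi> w = 0")
    case False
    then have "list_all2 (\<le>) (map fst w) (map snd w)" "deg w \<le> 0"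
      using assms unfolding upper_def bounded_by_def by force+
    then have "map fst w = map snd w" by (intro list_all2_le_sum_eq) (simp_all add: deg_def)
    then show ?thesis by (simp add: diag_part_def)
  qed (simp add: diag_part_def)
qed

lemma diag_word_upper: "upper (diag_word n t)"
  unfolding upper_def by (auto simp: diag_word_eq list_all2_refl)

lemma diag_word_bounded: "bounded_by 0 (diag_word n t)"
  unfolding bounded_by_def by (auto simp: diag_word_eq deg_def)

lemma diag_part_diag_word: "diag_part (diag_word n t) = diag_word n t"
  by (rule diag_part_self[OF diag_word_upper diag_word_bounded])

lemma E_eq: "E n r p i = lin_ext (E_word n r p i)"
  by (simp add: fun_eq_iff E_def lin_ext_def lsum_def)

lemma E_word_Cons:
  "E_word n r p i (x # w) = diag_word n (kappa r p (Suc i)) [x] * E_word n r p i w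
     + (if x = (i, Suc i) then 1 else 0) * diag_word n (kappa r p i) w"
  by (simp add: K_eq diag_char_def)

declare E_word.simps(2) [simp del]

lemma E_word_append:
  "E_word n r p i (v @ w) = diag_word n (kappa r p (Suc i)) v * E_word n r p i w
     + E_word n r p i v * diag_word n (kappa r p i) w"
proof (induction v)
  case (Cons x v)
  obtain a b where x: "x = (a, b)" by (cases x)
  have "diag_word n (kappa r p (Suc i)) (x # v) = diag_word n (kappa r p (Suc i)) [x] * diag_word n (kappa r p (Suc i)) v"
    by (simp add: x)
  then show ?case
    by (simp only: append_Cons E_word_Cons Cons diag_word_simps(3) distrib_left distrib_right mult.assoc add.assoc)
qed simp

text \<open>A word on which \<open>E\<^sub>i\<close> does not vanish consists of diagonal letters and a single \<open>T_i^{i+1}\<close>.\<close>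

lemma E_word_nonzero:
  "E_word n r p i w \<noteq> 0 \<Longrightarrow> list_all2 (\<le>) (map fst w) (map snd w) \<and> deg w = 1"
proof (induction w)
  case (Cons x w)
  obtain a b where x: "x = (a, b)" by (cases x)
  from Cons.prems consider "a = b" "E_word n r p i w \<noteq> 0" | "a = i" "b = Suc i" "diag_word n (kappa r p i) w \<noteq> 0"
    unfolding E_word_Cons by (auto simp: x split: if_splits)
  then show ?case
  proof cases
    case 1
    then show ?thesis using Cons.IH by (simp add: x deg_def)
  next
    case 2
    then show ?thesis by (auto simp: x deg_def diag_word_eq list_all2_refl split: if_splits)
  qed
qed simp

text \<open>On a word where \<open>E\<^sub>i\<close> does not vanish, diagonal letters contribute \<open>t\<^sub>a t\<^sub>a\<^sup>-\<^sup>1 = 1\<close> to the weights, and the letter \<open>T_i^{i+1}\<close> contributes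
  \<open>t\<^sub>i t\<^sub>i\<^sub>+\<^sub>1\<^sup>-\<^sup>1\<close>.\<close>

lemma E_word_scaling:
  assumes t: "\<And>i. i \<in> {1..n} \<Longrightarrow> t i \<noteq> 0" and i: "1 \<le> i" "i < n"
  shows "weight n t (map fst w) * weight n (\<lambda>i. inverse (t i)) (map snd w) * E_word n r p i w
    = t i * inverse (t (Suc i)) * E_word n r p i w"
proof (induction w)
  case (Cons x w)
  let ?s = "\<lambda>w. weight n t (map fst w) * weight n (\<lambda>i. inverse (t i)) (map snd w)"
  obtain a b where x: "x = (a, b)" by (cases x)
  have D: "?s w * diag_word n s w = diag_word n s w" for s
  proof (cases "map fst w = map snd w \<and> set (map fst w) \<subseteq> {1..n}")
    case True
    have "weight n (\<lambda>i. t i * inverse (t i)) (map fst w) = weight n (\<lambda>i. 1) (map fst w)"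
      unfolding weight_def using t by (intro arg_cong[where f = prod_list] map_cong) auto
    then have "?s w = 1"
      by (simp only: weight_mult weight_one conjunct2[OF True] if_True conjunct1[OF True, symmetric])
    then show ?thesis by simp
  next
    case False
    then have "diag_word n s w = 0" using weight_outside[of "map fst w" n s] by (auto simp only: diag_word_eq split: if_split)
    then show ?thesis by simp
  qed
  have X: "?s [x] * diag_word n s [x] = diag_word n s [x]" for s
    using t[of a] by (auto simp: x)
  have I: "?s [(i, Suc i)] = t i * inverse (t (Suc i))" using i by simp
  have S: "?s (x # w) = ?s [x] * ?s w"
    by (simp only: list.map weight_simps(1,2) mult_ac mult_1_left mult_1_right)
  have gen: "(P * Q) * (D * e + (if c then 1 else 0) * d) = (P * D) * (Q * e) + (if c then P else 0) * (Q * d)"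
    for P Q D e d :: 'a and c
    by (cases c) (simp_all only: if_True if_False distrib_left mult_ac mult_1_left mult_zero_left mult_zero_right)
  have "?s (x # w) * E_word n r p i (x # w) =
      (?s [x] * diag_word n (kappa r p (Suc i)) [x]) * (?s w * E_word n r p i w)
      + (if x = (i, Suc i) then ?s [x] else 0) * (?s w * diag_word n (kappa r p i) w)"
    unfolding S E_word_Cons by (rule gen)
  also have "\<dots> = diag_word n (kappa r p (Suc i)) [x] * (t i * inverse (t (Suc i)) * E_word n r p i w)
      + (if x = (i, Suc i) then t i * inverse (t (Suc i)) else 0) * diag_word n (kappa r p i) w"
    unfolding X D Cons.IH using I by (cases "x = (i, Suc i)") (simp_all only: if_True if_False refl)
  also have "\<dots> = t i * inverse (t (Suc i)) * E_word n r p i (x # w)"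
    unfolding E_word_Cons by (cases "x = (i, Suc i)") (simp_all only: refl if_True if_False distrib_left mult_ac mult_1_left mult_zero_left mult_zero_right)
  finally show ?case .
qed simp

section \<open>The coradical\<close>

lemma coprod_linear:
  "coprod 0 = 0" "coprod (u + v) = coprod u + coprod v" "coprod (fscale c u) = fscale c (coprod u)"
  by (auto simp: coprod_def fun_eq_iff fscale_def)

lemma corad_below_simps [simp]: "corad_below B 0 = {0}" "corad_below B (Suc m) = corad_filt B m"
  by (simp_all add: corad_below_def)

lemma set_plus_left: "0 \<in> W \<Longrightarrow> u \<in> U \<Longrightarrow> u \<in> U + (W :: ('a \<Rightarrow> 'k::field) set)"
  using set_plus_intro[of u U 0 W] by simp

lemma set_plus_right: "0 \<in> U \<Longrightarrow> w \<in> W \<Longrightarrow> w \<in> U + (W :: ('a \<Rightarrow> 'k::field) set)"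
  using set_plus_intro[of 0 U w W] by simp

locale frt =
  fixes n :: nat and r :: "'k::field" and p :: "nat \<Rightarrow> nat \<Rightarrow> 'k"
  assumes r: "r \<noteq> 0"
    and p: "\<And>i j. 1 \<le> i \<Longrightarrow> i < j \<Longrightarrow> j \<le> n \<Longrightarrow> p i j \<noteq> 0"
begin

abbreviation "\<kappa> \<equiv> kappa r p"
abbreviation "B \<equiv> Bl n r p"
abbreviation "ginv g \<equiv> inv\<^bsub>dual_monoid n r p\<^esub> g"

lemma kappa_nonzero: "i \<in> {1..n} \<Longrightarrow> j \<in> {1..n} \<Longrightarrow> \<kappa> i j \<noteq> 0"
  using r p unfolding kappa_def by auto

lemma kappa_symmetric: "i \<in> {1..n} \<Longrightarrow> j \<in> {1..n} \<Longrightarrow> i \<noteq> j \<Longrightarrow> \<kappa> i j * \<kappa> j i = r"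
  using p by (auto simp: kappa_def)

lemma kappa_diag: "\<kappa> i i = r"
  by (simp add: kappa_def)

lemma inv_K: "j \<in> {1..n} \<Longrightarrow> ginv (K n r p j) = diag_char n (\<lambda>i. inverse (\<kappa> j i))"
  unfolding K_eq by (rule inv_diag_char) (rule kappa_nonzero)

definition grouplikes :: "('k free_alg \<Rightarrow> 'k) set" where
  "grouplikes = {diag_char n t | t. (\<forall>i\<in>{1..n}. t i \<noteq> 0) \<and> diag_char n t \<in> B}"

lemma grouplikesI: "(\<And>i. i \<in> {1..n} \<Longrightarrow> t i \<noteq> 0) \<Longrightarrow> diag_char n t \<in> B \<Longrightarrow> diag_char n t \<in> grouplikes"
  unfolding grouplikes_def by blast

lemma grouplikesE:
  assumes "g \<in> grouplikes"
  obtains t where "g = diag_char n t" "\<And>i. i \<in> {1..n} \<Longrightarrow> t i \<noteq> 0" "diag_char n t \<in> B"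
  using assms unfolding grouplikes_def by blast

lemma grouplikes_times: "g \<in> grouplikes \<Longrightarrow> g (a * b) = g a * g b"
  by (auto elim!: grouplikesE simp: diag_char_times)

lemma grouplikes_one: "g \<in> grouplikes \<Longrightarrow> g 1 = 1"
  by (auto elim!: grouplikesE)

lemma coprod_grouplike: "g \<in> grouplikes \<Longrightarrow> coprod g = tensor g g"
  by (auto elim!: grouplikesE simp: coprod_diag_char)

lemma grouplikes_in_B: "g \<in> grouplikes \<Longrightarrow> g \<in> B"
  by (auto elim!: grouplikesE)

lemma independent_grouplikes: "fs.independent grouplikes"
proof (rule independent_characters)
  show "0 \<notin> grouplikes" using grouplikes_one by fastforce
qed (rule grouplikes_times)

lemma convol_grouplikes:
  assumes "g \<in> grouplikes" "h \<in> grouplikes" shows "convol n g h \<in> grouplikes"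
proof -
  obtain s where s: "g = diag_char n s" "\<And>i. i \<in> {1..n} \<Longrightarrow> s i \<noteq> 0"
    using assms(1) unfolding grouplikes_def by blast
  obtain t where t: "h = diag_char n t" "\<And>i. i \<in> {1..n} \<Longrightarrow> t i \<noteq> 0"
    using assms(2) unfolding grouplikes_def by blast
  have "convol n g h \<in> B" using assms by (intro Bl.convol grouplikes_in_B)
  then show ?thesis unfolding s(1) t(1) convol_diag_diag
    using s(2) t(2) by (intro grouplikesI) auto
qed

lemma K_grouplike: "j \<in> {1..n} \<Longrightarrow> K n r p j \<in> grouplikes"
  unfolding K_eq by (intro grouplikesI kappa_nonzero) (auto simp flip: K_eq intro: Bl.K)

lemma inv_K_grouplike: "j \<in> {1..n} \<Longrightarrow> ginv (K n r p j) \<in> grouplikes"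
  using Bl.K_inv[of j n r p] kappa_nonzero[of j] by (auto simp: inv_K intro!: grouplikesI)

lemma counit_grouplike: "counit n \<in> grouplikes"
  using Bl.unit[of n r p] by (auto simp: counit_eq intro!: grouplikesI)

lemma subspace_B: "fs.subspace B"
proof -
  have "0 \<in> B" using Bl.scale[OF Bl.unit[of n r p], of 0] by (simp only: fs.scale_zero_left)
  then show ?thesis unfolding fs.subspace_def using Bl.add Bl.scale by blast
qed

text \<open>The three properties hold for the generators and survive sums, multiples and convolution. Together
  they make an element of degree zero a combination of group-like elements.\<close>

lemma B_structure:
  assumes "u \<in> B"
  obtains \<phi> m where "u = lin_ext \<phi>" "upper \<phi>" "bounded_by m \<phi>"
    "lin_ext (diag_part \<phi>) \<in> fs.span grouplikes"
proof -
  define P where "P u \<longleftrightarrow> (\<exists>\<phi> m. u = lin_ext \<phi> \<and> upper \<phi> \<and> bounded_by m \<phi> \<and>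
    lin_ext (diag_part \<phi>) \<in> fs.span grouplikes)" for u :: "'k free_alg \<Rightarrow> 'k"
  have G: "P g" if g: "g \<in> grouplikes" for g
  proof -
    obtain t where t: "g = diag_char n t" using g by (rule grouplikesE)
    show ?thesis unfolding P_def
      using fs.span_base[OF g] diag_word_upper[of n t] diag_word_bounded[of n t]
      by (intro exI[of _ "diag_word n t"] exI[of _ 0]) (simp add: diag_part_diag_word t diag_char_def)
  qed
  from assms have "P u"
  proof (induction rule: Bl.induct)
    case (K j)
    then show ?case by (intro G K_grouplike) simp
  next
    case (K_inv j)
    then show ?case by (intro G inv_K_grouplike) simp
  next
    case (E i)
    let ?\<phi> = "E_word n r p i"
    have nz: "?\<phi> w \<noteq> 0 \<Longrightarrow> list_all2 (\<le>) (map fst w) (map snd w) \<and> deg w = 1" for w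
      by (rule E_word_nonzero)
    have "upper ?\<phi>" using nz unfolding upper_def by blast
    moreover have "bounded_by 1 ?\<phi>" using nz unfolding bounded_by_def by fastforce
    moreover have "diag_part ?\<phi> = (\<lambda>w. 0)"
    proof
      fix w show "diag_part ?\<phi> w = 0"
        using nz[of w] by (cases "?\<phi> w = 0") (auto simp: diag_part_def deg_def)
    qed
    then have "lin_ext (diag_part ?\<phi>) = 0" by (simp add: lin_ext_def lsum_def fun_eq_iff)
    then have "lin_ext (diag_part ?\<phi>) \<in> fs.span grouplikes" by (simp only: fs.span_zero)
    ultimately show ?case unfolding P_def E_eq by blast
  next
    case unit
    then show ?case by (intro G counit_grouplike)
  next
    case (add u v)
    from add.IH(1) obtain \<phi> a where \<phi>: "u = lin_ext \<phi>" "upper \<phi>" "bounded_by a \<phi>"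
      "lin_ext (diag_part \<phi>) \<in> fs.span grouplikes" unfolding P_def by blast
    from add.IH(2) obtain \<psi> b where \<psi>: "v = lin_ext \<psi>" "upper \<psi>" "bounded_by b \<psi>"
      "lin_ext (diag_part \<psi>) \<in> fs.span grouplikes" unfolding P_def by blast
    let ?\<chi> = "\<lambda>w. \<phi> w + \<psi> w"
    have "upper ?\<chi>" using \<phi>(2) \<psi>(2) unfolding upper_def by (metis add_0)
    moreover have "bounded_by (a + b) ?\<chi>" using \<phi>(3) \<psi>(3) unfolding bounded_by_def by simp
    moreover have "diag_part ?\<chi> = (\<lambda>w. diag_part \<phi> w + diag_part \<psi> w)"
      by (rule ext) (simp add: diag_part_def)
    then have "lin_ext (diag_part ?\<chi>) = lin_ext (diag_part \<phi>) + lin_ext (diag_part \<psi>)"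
      by (simp only: lin_ext_add)
    then have "lin_ext (diag_part ?\<chi>) \<in> fs.span grouplikes"
      using fs.span_add[OF \<phi>(4) \<psi>(4)] by (simp only:)
    ultimately show ?case unfolding P_def \<phi>(1) \<psi>(1) lin_ext_add by blast
  next
    case (scale u c)
    from scale.IH obtain \<phi> a where \<phi>: "u = lin_ext \<phi>" "upper \<phi>" "bounded_by a \<phi>"
      "lin_ext (diag_part \<phi>) \<in> fs.span grouplikes" unfolding P_def by blast
    let ?\<chi> = "\<lambda>w. c * \<phi> w"
    have "upper ?\<chi>" using \<phi>(2) unfolding upper_def by (metis mult_zero_right)
    moreover have "bounded_by a ?\<chi>" using \<phi>(3) unfolding bounded_by_def by simp
    moreover have "diag_part ?\<chi> = (\<lambda>w. c * diag_part \<phi> w)"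
      by (rule ext) (simp add: diag_part_def)
    then have "lin_ext (diag_part ?\<chi>) = fscale c (lin_ext (diag_part \<phi>))"
      by (simp only: lin_ext_scale)
    then have "lin_ext (diag_part ?\<chi>) \<in> fs.span grouplikes"
      using fs.span_scale[OF \<phi>(4)] by (simp only:)
    ultimately show ?case unfolding P_def \<phi>(1) lin_ext_scale by blast
  next
    case (convol u v)
    from convol.IH(1) obtain \<phi> a where \<phi>: "u = lin_ext \<phi>" "upper \<phi>" "bounded_by a \<phi>"
      "lin_ext (diag_part \<phi>) \<in> fs.span grouplikes" unfolding P_def by blast
    from convol.IH(2) obtain \<psi> b where \<psi>: "v = lin_ext \<psi>" "upper \<psi>" "bounded_by b \<psi>"
      "lin_ext (diag_part \<psi>) \<in> fs.span grouplikes" unfolding P_def by blast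
    have "convol n (lin_ext (diag_part \<phi>)) (lin_ext (diag_part \<psi>)) \<in> fs.span grouplikes"
      by (rule convol_span[OF _ fs.subspace_span \<phi>(4) \<psi>(4)]) (intro fs.span_base convol_grouplikes)
    then have "lin_ext (diag_part (word_conv n \<phi> \<psi>)) \<in> fs.span grouplikes"
      by (simp only: diag_part_word_conv[OF \<phi>(2) \<psi>(2)] convol_lin_ext)
    then show ?case unfolding P_def \<phi>(1) \<psi>(1) convol_lin_ext
      using upper_word_conv[OF \<phi>(2) \<psi>(2)] bounded_word_conv[OF \<phi>(3) \<psi>(3)] by blast
  qed
  with that show thesis unfolding P_def by blast
qed

lemma line_subcoalgebra:
  assumes "g \<in> grouplikes" shows "subcoalgebra (fs.span {g})"
proof -
  have "fs.span {g} \<subseteq> {u. coprod u \<in> tensor_space (fs.span {g}) (fs.span {g})}"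
  proof (rule fs.span_minimal)
    show "{g} \<subseteq> {u. coprod u \<in> tensor_space (fs.span {g}) (fs.span {g})}"
      using coprod_grouplike[OF assms] by (auto intro!: tensor_in_tensor_space fs.span_base)
    show "fs.subspace {u. coprod u \<in> tensor_space (fs.span {g}) (fs.span {g})}"
      using subspace_tensor_space[of "fs.span {g}" "fs.span {g}"]
      unfolding fs.subspace_def mem_Collect_eq coprod_linear by blast
  qed
  then show ?thesis unfolding subcoalgebra_def by auto
qed

lemma subspace_line:
  assumes "fs.subspace D" "D \<subseteq> fs.span {g}" shows "D = {0} \<or> D = fs.span {g}"
proof (cases "D \<subseteq> {0}")
  case True
  then show ?thesis using fs.subspace_0[OF assms(1)] by blast
next
  case False
  then obtain d where d: "d \<in> D" "d \<noteq> 0" by blast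
  then obtain c where c: "d = fscale c g"
    using assms(2) by (auto simp: fs.span_singleton)
  with d(2) have "c \<noteq> 0" using fs.scale_zero_left by metis
  then have "g = fscale (inverse c) d" unfolding c by (simp add: fs.scale_scale)
  then have "g \<in> D" using fs.subspace_scale[OF assms(1) d(1)] by metis
  then have "fs.span {g} \<subseteq> D" using assms(1) by (intro fs.span_minimal) auto
  with assms(2) show ?thesis by blast
qed

lemma line_simple:
  assumes "g \<in> grouplikes" shows "simple_subcoalgebra (fs.span {g})"
proof -
  have "g \<in> fs.span {g}" "g \<noteq> 0"
    using grouplikes_one[OF assms] by (auto intro: fs.span_base)
  then have "fs.span {g} \<noteq> {0}" by blast
  moreover have "D = {0} \<or> D = fs.span {g}" if "subcoalgebra D \<and> D \<subseteq> fs.span {g}" for D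
    using that by (intro subspace_line) (simp_all add: subcoalgebra_def)
  ultimately show ?thesis unfolding simple_subcoalgebra_def
    using line_subcoalgebra[OF assms] by (intro conjI allI impI)
qed

lemma subcoalgebra_translate:
  assumes "subcoalgebra C" "u \<in> C" shows "(\<lambda>a. u (a * b)) \<in> C"
proof -
  have "(\<lambda>a. coprod u (a, b)) \<in> C"
    using assms unfolding subcoalgebra_def by (intro slice_left_in[of C _ C]) auto
  then show ?thesis by (simp add: coprod_def)
qed

text \<open>A subcoalgebra is closed under translations. They bring a nonzero element down to degree zero, where
  it is a combination of group-like elements, and then separate these from each other.\<close>

lemma subcoalgebra_contains_grouplike:
  assumes C: "subcoalgebra C" "C \<subseteq> B" "C \<noteq> {0}"
  shows "\<exists>g\<in>grouplikes. g \<in> C"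
proof -
  have sub: "fs.subspace C" using C(1) unfolding subcoalgebra_def by blast
  have low: "\<exists>x\<in>C. x \<noteq> 0 \<and> bounded_by 0 (on_word x)"
    if "x \<in> C" "x \<noteq> 0" "bounded_by m (on_word x)" for m x
    using that
  proof (induction m arbitrary: x)
    case (Suc m)
    show ?case
    proof (cases "bounded_by m (on_word x)")
      case True
      then show ?thesis using Suc by blast
    next
      case False
      then obtain w where w: "deg w > int m" "on_word x w \<noteq> 0" unfolding bounded_by_def by blast
      let ?y = "\<lambda>a. x (a * Poly_Mapping.single (Mon w) 1)"
      have y: "on_word ?y v = on_word x (v @ w)" for v
        by (simp add: on_word_def mult_single plus_monomial_def)
      \<comment> \<open>Translating by a word of top degree leaves only degree zero, and the value at the empty word
        is the nonzero value at that word.\<close>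
      have yC: "?y \<in> C" using Suc.prems(1) by (rule subcoalgebra_translate[OF C(1)])
      have "on_word ?y [] \<noteq> 0" unfolding y using w(2) by simp
      moreover have "on_word (0 :: 'k free_alg \<Rightarrow> 'k) [] = 0" by (simp add: on_word_def)
      ultimately have "?y \<noteq> 0" by metis
      moreover have "bounded_by 0 (on_word ?y)"
        unfolding bounded_by_def y
      proof (intro allI impI)
        fix v assume "int 0 < deg v"
        then have "deg (v @ w) > int (Suc m)" using w(1) by (simp add: deg_def)
        then show "on_word x (v @ w) = 0" using Suc.prems(3) unfolding bounded_by_def by blast
      qed
      ultimately show ?thesis using yC by blast
    qed
  qed blast
  obtain x0 where x0: "x0 \<in> C" "x0 \<noteq> 0" using C(3) fs.subspace_0[OF sub] by blast
  obtain \<phi>0 m where "x0 = lin_ext \<phi>0" "bounded_by m \<phi>0"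
    using x0(1) C(2) by (meson B_structure subsetD)
  then obtain x where x: "x \<in> C" "x \<noteq> 0" "bounded_by 0 (on_word x)"
    using low[OF x0, of m] by auto
  obtain \<phi> where \<phi>: "x = lin_ext \<phi>" "upper \<phi>" "lin_ext (diag_part \<phi>) \<in> fs.span grouplikes"
    using x(1) C(2) by (meson B_structure subsetD)
  have "diag_part \<phi> = \<phi>" using x(3) \<phi>(1,2) by (intro diag_part_self) simp_all
  with \<phi> have "x \<in> fs.span grouplikes" by simp
  then obtain T c where T: "finite T" "T \<subseteq> grouplikes" "x = (\<Sum>g\<in>T. fscale (c g) g)"
    unfolding fs.span_explicit by blast
  let ?T = "{g \<in> T. c g \<noteq> 0}"
  have sum: "(\<Sum>g\<in>?T. fscale (c g) g) = x"
    unfolding T(3) using T(1) by (intro sum.mono_neutral_left) (auto simp: fscale_def fun_eq_iff)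
  have "?T \<subseteq> C"
  proof (rule translation_closed_contains_characters[OF sub subcoalgebra_translate[OF C(1)]])
    show "(\<Sum>g\<in>?T. fscale (c g) g) \<in> C" unfolding sum by (rule x(1))
  qed (use T(1,2) grouplikes_times in auto)
  moreover have "?T \<noteq> {}" using sum x(2) by (metis (no_types, lifting) sum.empty)
  ultimately show ?thesis using T(2) by blast
qed

text \<open>By the preceding lemma the simple subcoalgebras are exactly the lines spanned by group-like
  elements, so the Hopf algebra is pointed.\<close>

lemma coradical_B: "coradical B = fs.span grouplikes"
proof
  have "C \<subseteq> fs.span grouplikes" if C: "C \<subseteq> B" "simple_subcoalgebra C" for C
  proof -
    have sc: "subcoalgebra C" "C \<noteq> {0}" using C(2) unfolding simple_subcoalgebra_def by blast+
    obtain g where g: "g \<in> grouplikes" "g \<in> C"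
      using subcoalgebra_contains_grouplike[OF sc(1) C(1) sc(2)] by blast
    have "fs.span {g} \<subseteq> C"
      using g(2) sc(1) unfolding subcoalgebra_def by (intro fs.span_minimal) auto
    then have "fs.span {g} = C"
      using line_subcoalgebra[OF g(1)] line_simple[OF g(1)] C(2) unfolding simple_subcoalgebra_def by blast
    then show ?thesis using fs.span_mono[of "{g}" grouplikes] g(1) by auto
  qed
  then show "coradical B \<subseteq> fs.span grouplikes"
    unfolding coradical_def by (intro fs.span_minimal) auto
  have "grouplikes \<subseteq> \<Union>{C. C \<subseteq> B \<and> simple_subcoalgebra C}"
  proof
    fix g assume g: "g \<in> grouplikes"
    then have "fs.span {g} \<subseteq> B"
      using grouplikes_in_B subspace_B by (intro fs.span_minimal) auto
    with g line_simple[OF g] show "g \<in> \<Union>{C. C \<subseteq> B \<and> simple_subcoalgebra C}"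
      by (auto intro: fs.span_base)
  qed
  then show "fs.span grouplikes \<subseteq> coradical B"
    unfolding coradical_def by (rule fs.span_mono)
qed

end

section \<open>The skew-primitive elements\<close>

lemma UN_constant_family:
  assumes "X \<noteq> {}" "Y \<noteq> {}" "\<And>u v. u \<in> X \<Longrightarrow> v \<in> Y \<Longrightarrow> F u v = C"
  shows "(\<Union>u\<in>X. \<Union>v\<in>Y. F u v) = C"
  using assms by blast

lemma coset_nonempty: "fs.subspace N \<Longrightarrow> u +o N \<noteq> {}"
  using fs.subspace_0 by (force simp: elt_set_plus_def)

lemma coset_memE:
  assumes "x \<in> u +o N" obtains b where "x = u + b" "b \<in> N"
  using assms unfolding elt_set_plus_def by blast

lemma diag_word_times_weight:
  "weight n s (map snd w) * diag_word n t w = diag_word n (\<lambda>i. s i * t i) w"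
  by (simp add: diag_word_eq weight_mult)

(* The terms of the coradical filtration enter only as subspaces. *)
declare corad_filt.simps [simp del]

context frt
begin

definition x_word :: "nat \<Rightarrow> word \<Rightarrow> 'k" where
  "x_word i w = weight n (\<lambda>j. inverse (\<kappa> i j)) (map snd w) * E_word n r p i w"

text \<open>The group-like element \<open>K\<^sub>i\<^sup>-\<^sup>1 K\<^sub>i\<^sub>+\<^sub>1\<close> as a diagonal character.\<close>

definition kbar :: "nat \<Rightarrow> 'k free_alg \<Rightarrow> 'k" where
  "kbar i = diag_char n (\<lambda>j. inverse (\<kappa> i j) * \<kappa> (Suc i) j)"

abbreviation "x \<equiv> x_elt n r p"

lemma x_eq: "i \<in> {1..n} \<Longrightarrow> x i = lin_ext (x_word i)"
  unfolding x_elt_def x_word_def by (simp only: inv_K E_eq convol_diag_right)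

lemma kbar_eq: "i \<in> {1..n} \<Longrightarrow> convol n (ginv (K n r p i)) (K n r p (Suc i)) = kbar i"
  unfolding kbar_def by (simp only: inv_K) (simp only: K_eq convol_diag_diag)

lemma kbar_grouplike:
  assumes "i \<in> {1..n-1}" shows "kbar i \<in> grouplikes"
proof -
  have "i \<in> {1..n}" "Suc i \<in> {1..n}" using assms by auto
  then show ?thesis
    by (simp only: kbar_eq[symmetric]) (intro convol_grouplikes inv_K_grouplike K_grouplike)
qed

text \<open>The factor \<open>K\<^sub>i\<close> in the coproduct of \<open>E\<^sub>i\<close> cancels against \<open>K\<^sub>i\<^sup>-\<^sup>1\<close>, which leaves the counit.\<close>

lemma x_word_append:
  assumes "i \<in> {1..n}"
  shows "x_word i (v @ w) = diag_word n (\<lambda>j. inverse (\<kappa> i j) * \<kappa> (Suc i) j) v * x_word i w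
    + x_word i v * diag_word n (\<lambda>j. 1) w"
proof -
  let ?s = "\<lambda>j. inverse (\<kappa> i j)"
  have one: "diag_word n (\<lambda>j. ?s j * \<kappa> i j) = diag_word n (\<lambda>j. 1)"
    using kappa_nonzero[OF assms] by (intro diag_word_cong) simp
  have gen: "(a * b) * (c * d + e * f) = (a * c) * (b * d) + (a * e) * (b * f)" for a b c d e f :: 'k
    by (simp only: distrib_left mult_ac)
  have "x_word i (v @ w) = (weight n ?s (map snd v) * weight n ?s (map snd w)) *
      (diag_word n (\<kappa> (Suc i)) v * E_word n r p i w + E_word n r p i v * diag_word n (\<kappa> i) w)"
    by (simp only: x_word_def map_append weight_simps(3) E_word_append)
  then show ?thesis
    by (simp only: gen diag_word_times_weight one x_word_def)
qed

lemma coprod_x: "i \<in> {1..n} \<Longrightarrow> coprod (x i) = tensor (kbar i) (x i) + tensor (x i) (counit n)"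
  unfolding x_eq kbar_def counit_eq diag_char_def by (rule coprod_lin_ext2) (rule x_word_append)

lemma x_in_B: "i \<in> {1..n-1} \<Longrightarrow> x i \<in> B"
  unfolding x_elt_def by (intro Bl.convol Bl.E Bl.K_inv) auto

text \<open>For the diagonal character with entries \<open>t\<close> this is \<open>t\<^sub>j / t\<^sub>j\<^sub>+\<^sub>1\<close>. Reading the entries off the generators
  makes it a function of \<open>g\<close> alone.\<close>

definition eigenvalue :: "nat \<Rightarrow> ('k free_alg \<Rightarrow> 'k) \<Rightarrow> 'k" where
  "eigenvalue j g = g (T_gen j j) * inverse (g (T_gen (Suc j) (Suc j)))"

lemma conjugate_x:
  assumes g: "g \<in> grouplikes" and j: "j \<in> {1..n-1}"
  shows "convol n (convol n g (x j)) (ginv g) = fscale (eigenvalue j g) (x j)"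
proof -
  obtain t where t: "g = diag_char n t" "\<And>i. i \<in> {1..n} \<Longrightarrow> t i \<noteq> 0"
    using g unfolding grouplikes_def by blast
  have j': "j \<in> {1..n}" "1 \<le> j" "j < n" "Suc j \<in> {1..n}" using j by auto
  have ev: "eigenvalue j g = t j * inverse (t (Suc j))"
    using j' by (simp only: eigenvalue_def t(1) diag_char_T_gen simp_thms if_True)
  have "weight n (\<lambda>i. inverse (t i)) (map snd w) * (weight n t (map fst w) * x_word j w) =
      eigenvalue j g * x_word j w" for w
  proof -
    let ?s = "weight n (\<lambda>i. inverse (\<kappa> j i)) (map snd w)"
    have "weight n (\<lambda>i. inverse (t i)) (map snd w) * (weight n t (map fst w) * x_word j w) =
        ?s * (weight n t (map fst w) * weight n (\<lambda>i. inverse (t i)) (map snd w) * E_word n r p j w)"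
      by (simp only: x_word_def mult_ac)
    also have "\<dots> = ?s * (t j * inverse (t (Suc j)) * E_word n r p j w)"
      by (simp only: E_word_scaling[OF t(2) j'(2,3)])
    finally show ?thesis by (simp only: x_word_def ev mult_ac)
  qed
  moreover have "ginv (diag_char n t) = diag_char n (\<lambda>i. inverse (t i))"
    using t(2) by (rule inv_diag_char)
  ultimately show ?thesis
    unfolding t(1) x_eq[OF j'(1)] convol_diag_left lin_ext_scale
    by (simp only: t(1) convol_diag_right)
qed

section \<open>Degrees zero and one of the graded Hopf algebra\<close>

abbreviation "B0 \<equiv> corad_filt B 0"
abbreviation "B1 \<equiv> corad_filt B 1"

lemma B0_eq: "B0 = fs.span grouplikes"
  using coradical_B by (simp add: corad_filt.simps)

lemma subspace_B0: "fs.subspace B0"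
  unfolding B0_eq by (rule fs.subspace_span)

lemma B0_subset_B: "B0 \<subseteq> B"
  unfolding B0_eq using grouplikes_in_B subspace_B by (intro fs.span_minimal) auto

lemma grouplike_in_B0: "g \<in> grouplikes \<Longrightarrow> g \<in> B0"
  unfolding B0_eq by (rule fs.span_base)

lemma B1_eq: "B1 = {u \<in> B. coprod u \<in> tensor_space B B0 + tensor_space B0 B}"
  by (simp add: corad_filt.simps)

lemma coprod_B0: "u \<in> B0 \<Longrightarrow> coprod u \<in> tensor_space B0 B0"
proof -
  have "fs.span grouplikes \<subseteq> {u. coprod u \<in> tensor_space B0 B0}"
  proof (rule fs.span_minimal)
    show "grouplikes \<subseteq> {u. coprod u \<in> tensor_space B0 B0}"
      using tensor_in_tensor_space[OF grouplike_in_B0 grouplike_in_B0]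
      by (auto simp only: coprod_grouplike mem_Collect_eq subset_iff)
    show "fs.subspace {u. coprod u \<in> tensor_space B0 B0}"
      using subspace_tensor_space[of B0 B0] unfolding fs.subspace_def mem_Collect_eq coprod_linear by blast
  qed
  then show "u \<in> B0 \<Longrightarrow> coprod u \<in> tensor_space B0 B0" unfolding B0_eq by blast
qed

lemma subspace_B1: "fs.subspace B1"
proof -
  have "fs.subspace (tensor_space B B0 + tensor_space B0 B)"
    by (intro subspace_set_plus subspace_tensor_space)
  then show ?thesis using subspace_B
    unfolding B1_eq fs.subspace_def mem_Collect_eq coprod_linear by blast
qed

lemma zero_in_tensor_space: "0 \<in> tensor_space U W"
  using fs.subspace_0[OF subspace_tensor_space] .

lemma B0_subset_B1: "B0 \<subseteq> B1"
proof
  fix u assume u: "u \<in> B0"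
  have "coprod u \<in> tensor_space B B0"
    using coprod_B0[OF u] tensor_space_mono[OF B0_subset_B subset_refl, of B0] by blast
  then have "coprod u \<in> tensor_space B B0 + tensor_space B0 B"
    by (intro set_plus_left zero_in_tensor_space)
  with u B0_subset_B show "u \<in> B1" unfolding B1_eq by blast
qed

lemma x_in_B1:
  assumes i: "i \<in> {1..n-1}" shows "x i \<in> B1"
proof -
  have "i \<in> {1..n}" using i by auto
  note c = coprod_x[OF this]
  have "tensor (x i) (counit n) + tensor (kbar i) (x i) \<in> tensor_space B B0 + tensor_space B0 B"
    using i by (intro set_plus_intro tensor_in_tensor_space x_in_B grouplike_in_B0 kbar_grouplike counit_grouplike)
  then show ?thesis using x_in_B[OF i] unfolding B1_eq mem_Collect_eq c by (simp only: add.commute)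
qed

abbreviation "N01 \<equiv> gr_ker2 B 0 1"
abbreviation "N11 \<equiv> gr_ker2 B 1 1"

lemma N01_eq: "N01 = tensor_space B0 B0"
proof -
  have "tensor_space ({0} :: ('k free_alg \<Rightarrow> 'k) set) W = {0}" for W :: "('k free_alg \<Rightarrow> 'k) set"
    using tensor_space_zero_left[of W] zero_in_tensor_space[of _ W] by blast
  then show ?thesis unfolding gr_ker2_def One_nat_def corad_below_simps by (simp only: set_add_0)
qed

lemma N11_eq: "N11 = tensor_space B0 B1 + tensor_space B1 B0"
  unfolding gr_ker2_def One_nat_def corad_below_simps ..

lemma subspace_N01: "fs.subspace N01"
  unfolding N01_eq by (rule subspace_tensor_space)

lemma subspace_N11: "fs.subspace N11"
  unfolding N11_eq by (intro subspace_set_plus subspace_tensor_space)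

lemma gr_class_0: "gr_class B 0 u = {u}"
  by (auto simp: gr_class_def elt_set_plus_def)

lemma gr_class_1: "gr_class B 1 u = u +o B0"
  by (simp only: gr_class_def One_nat_def corad_below_simps)

lemma gr_tensor_1_1:
  assumes "u \<in> B1" "w \<in> B1"
  shows "gr_tensor B 1 1 (u +o B0) (w +o B0) = tensor u w +o N11"
  unfolding gr_tensor_def
proof (rule UN_constant_family[OF coset_nonempty coset_nonempty, OF subspace_B0 subspace_B0])
  fix u' w' assume "u' \<in> u +o B0" "w' \<in> w +o B0"
  then obtain b c where b: "u' = u + b" "b \<in> B0" and c: "w' = w + c" "c \<in> B0"
    by (auto elim!: coset_memE)
  have "w' \<in> B1"
    unfolding c(1) using B0_subset_B1 c(2) by (intro fs.subspace_add[OF subspace_B1 assms(2)]) blast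
  then have "tensor b w' + tensor u c \<in> N11"
    unfolding N11_eq using assms b c by (intro set_plus_intro tensor_in_tensor_space)
  moreover have "tensor b w' + tensor u c = tensor u' w' - tensor u w"
    unfolding b(1) c(1) by (simp only: tensor_simps algebra_simps)
  ultimately show "tensor u' w' +o N11 = tensor u w +o N11"
    by (simp only: coset_eq[OF subspace_N11])
qed

lemma gr_tensor_0_1:
  assumes "g \<in> grouplikes"
  shows "gr_tensor B 0 1 (gr_class B 0 g) (w +o B0) = tensor g w +o N01"
  unfolding gr_tensor_def gr_class_0
proof (rule UN_constant_family[OF _ coset_nonempty[OF subspace_B0]])
  fix u' w' assume u': "u' \<in> {g}" and "w' \<in> w +o B0"
  then obtain c where c: "w' = w + c" "c \<in> B0" by (auto elim!: coset_memE)
  have "tensor g c \<in> N01"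
    unfolding N01_eq using grouplike_in_B0[OF assms] c(2) by (intro tensor_in_tensor_space)
  moreover have "tensor g c = tensor g w' - tensor g w"
    unfolding c(1) by (simp only: tensor_simps algebra_simps)
  moreover have "u' = g" using u' by simp
  ultimately show "tensor u' w' +o N01 = tensor g w +o N01"
    by (simp only: coset_eq[OF subspace_N01])
qed simp

lemma x_gr_eq: "x_gr n r p i = x i +o B0"
  by (simp only: x_gr_def gr_class_1)

lemma convol_B0:
  assumes "g \<in> grouplikes" "b \<in> B0"
  shows "convol n g b \<in> B0" "convol n b g \<in> B0"
proof -
  have b: "b \<in> fs.span grouplikes" using assms(2) unfolding B0_eq .
  have g: "g \<in> fs.span grouplikes" using assms(1) by (rule fs.span_base)
  show "convol n g b \<in> B0" unfolding B0_eq
    by (rule convol_span[OF _ fs.subspace_span g b]) (intro fs.span_base convol_grouplikes)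
  show "convol n b g \<in> B0" unfolding B0_eq
    by (rule convol_span[OF _ fs.subspace_span b g]) (intro fs.span_base convol_grouplikes)
qed

lemma gr_mult_0_1:
  assumes g: "g \<in> grouplikes"
  shows "gr_mult n r p 0 1 {g} (u +o B0) = convol n g u +o B0"
  unfolding gr_mult_def add_0 gr_class_1
proof (rule UN_constant_family[OF _ coset_nonempty[OF subspace_B0]])
  fix g' u' assume g': "g' \<in> {g}" and "u' \<in> u +o B0"
  then obtain b where b: "u' = u + b" "b \<in> B0" by (auto elim!: coset_memE)
  have "g' = g" using g' by simp
  moreover have "convol n g b = convol n g u' - convol n g u"
    unfolding b(1) by (simp only: convol_linear algebra_simps)
  ultimately show "convol n g' u' +o B0 = convol n g u +o B0"
    using convol_B0(1)[OF g b(2)] by (simp only: coset_eq[OF subspace_B0])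
qed simp

lemma gr_mult_1_0:
  assumes g: "g \<in> grouplikes"
  shows "gr_mult n r p 1 0 (u +o B0) {g} = convol n u g +o B0"
  unfolding gr_mult_def add_0_right gr_class_1
proof (rule UN_constant_family[OF coset_nonempty[OF subspace_B0]])
  fix g' u' assume g': "g' \<in> {g}" and "u' \<in> u +o B0"
  then obtain b where b: "u' = u + b" "b \<in> B0" by (auto elim!: coset_memE)
  have "g' = g" using g' by simp
  moreover have "convol n b g = convol n u' g - convol n u g"
    unfolding b(1) by (simp only: convol_linear algebra_simps)
  ultimately show "convol n u' g' +o B0 = convol n u g +o B0"
    using convol_B0(2)[OF g b(2)] by (simp only: coset_eq[OF subspace_B0])
qed simp

lemma inv_kbar:
  assumes "i \<in> {1..n-1}"
  shows "ginv (kbar i) \<in> grouplikes" "ginv (ginv (kbar i)) = kbar i"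
proof -
  have i: "i \<in> {1..n}" "Suc i \<in> {1..n}" using assms by auto
  let ?t = "\<lambda>j. \<kappa> i j * inverse (\<kappa> (Suc i) j)"
  have h: "ginv (kbar i) = diag_char n ?t"
    unfolding kbar_def using kappa_nonzero i by (subst inv_diag_char) (auto intro!: diag_char_cong)
  also have "\<dots> = convol n (K n r p i) (ginv (K n r p (Suc i)))"
    using i by (simp only: inv_K) (simp only: K_eq convol_diag_diag)
  finally show "ginv (kbar i) \<in> grouplikes"
    using i by (simp only:) (intro convol_grouplikes K_grouplike inv_K_grouplike)
  have "ginv (ginv (kbar i)) = diag_char n (\<lambda>j. inverse (?t j))"
    unfolding h using kappa_nonzero i by (intro inv_diag_char) auto
  also have "\<dots> = kbar i"
    unfolding kbar_def by (rule diag_char_cong) simp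
  finally show "ginv (ginv (kbar i)) = kbar i" .
qed

lemma SLG_grouplike:
  assumes "g \<in> SLG n r p"
  shows "g \<in> grouplikes \<and> ginv g \<in> grouplikes"
  using assms unfolding SLG_def
proof (induction rule: generate.induct)
  case one
  have "ginv (counit n) = counit n" unfolding counit_eq by (subst inv_diag_char) auto
  then show ?case using counit_grouplike by (simp add: dual_monoid_def[of n r p])
next
  case (incl h)
  then obtain i where "i \<in> {1..n-1}" "h = kbar i" using kbar_eq by fastforce
  with kbar_grouplike inv_kbar show ?case by blast
next
  case (inv h)
  then obtain i where "i \<in> {1..n-1}" "h = kbar i" using kbar_eq by fastforce
  with kbar_grouplike inv_kbar show ?case by metis
next
  case (eng g h)
  obtain s where s: "g = diag_char n s" "\<And>i. i \<in> {1..n} \<Longrightarrow> s i \<noteq> 0"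
    using eng.IH(1) unfolding grouplikes_def by blast
  obtain t where t: "h = diag_char n t" "\<And>i. i \<in> {1..n} \<Longrightarrow> t i \<noteq> 0"
    using eng.IH(2) unfolding grouplikes_def by blast
  have "ginv (diag_char n s) = diag_char n (\<lambda>i. inverse (s i))"
    "ginv (diag_char n t) = diag_char n (\<lambda>i. inverse (t i))"
    using s(2) t(2) by (intro inv_diag_char; blast)+
  moreover have "ginv (diag_char n (\<lambda>i. s i * t i)) = diag_char n (\<lambda>i. inverse (s i * t i))"
    using s(2) t(2) by (intro inv_diag_char) simp
  ultimately have "ginv (convol n g h) = convol n (ginv g) (ginv h)"
    by (simp only: s(1) t(1) convol_diag_diag inverse_mult_distrib)
  then show ?case using eng.IH convol_grouplikes by (simp add: dual_monoid_def[of n r p])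
qed

lemma kbar_in_SLG: "i \<in> {1..n-1} \<Longrightarrow> kbar i \<in> SLG n r p"
  unfolding SLG_def by (rule generate.incl) (use kbar_eq[of i] in force)

section \<open>The braiding\<close>

lemma ad_act_x:
  assumes g: "g \<in> SLG n r p" and j: "j \<in> {1..n-1}"
  shows "ad_act n r p g (x_gr n r p j) = fscale (eigenvalue j g) (x j) +o B0"
proof -
  note G = SLG_grouplike[OF g]
  show ?thesis
    by (simp only: ad_act_def gr_class_0 x_gr_eq gr_mult_0_1[OF conjunct1[OF G]]
        gr_mult_1_0[OF conjunct2[OF G]] conjugate_x[OF conjunct1[OF G] j])
qed

text \<open>The summand \<open>x\<^sub>i \<otimes> 1\<close> of the coproduct lies in \<open>B\<^sub>1 \<otimes> B\<^sub>0\<close> and is discarded. Two representatives of the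
  component in bidegree \<open>(0, 1)\<close> differ by an element of \<open>B\<^sub>0 \<otimes> B\<^sub>1\<close> and of \<open>B\<^sub>1 \<otimes> B\<^sub>0\<close>, hence of
  \<open>B\<^sub>0 \<otimes> B\<^sub>0\<close>, because the group-like elements are a basis of \<open>B\<^sub>0\<close>.\<close>

lemma coact_x:
  assumes i: "i \<in> {1..n-1}"
  shows "coact n r p (x_gr n r p i) = tensor (kbar i) (x i) +o N01"
proof -
  have i': "i \<in> {1..n}" using i by auto
  have "{0..0 + 1} - {0 :: nat} = {1}" by auto
  then have S: "(\<Sum>k\<in>{0..0 + 1} - {0}. tensor_space (corad_filt B k) (corad_filt B (0 + 1 - k))) = tensor_space B1 B0"
    by (simp only: sum.insert sum.empty finite.emptyI empty_iff not_False_eq_True add_0_right add_0 diff_self_eq_0)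
  have sub10: "fs.subspace (tensor_space B1 B0)" by (rule subspace_tensor_space)
  have b00: "tensor_space B0 B0 \<subseteq> tensor_space B1 B0" "tensor_space B0 B0 \<subseteq> tensor_space B0 B1"
    using tensor_space_mono[OF B0_subset_B1 subset_refl] tensor_space_mono[OF subset_refl B0_subset_B1] by blast+
  have x1: "tensor (x i) (counit n) \<in> tensor_space B1 B0"
    using x_in_B1[OF i] grouplike_in_B0[OF counit_grouplike] by (rule tensor_in_tensor_space)
  have kx: "tensor (kbar i) (x i) \<in> tensor_space B0 B1"
    using grouplike_in_B0[OF kbar_grouplike[OF i]] x_in_B1[OF i] by (rule tensor_in_tensor_space)
  show ?thesis unfolding coact_def gr_coprod_def S x_gr_eq
  proof (intro equalityI subsetI)
    fix s assume "s \<in> {s \<in> tensor_space B0 B1. \<exists>u\<in>x i +o B0. coprod u \<in> s +o tensor_space B1 B0}"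
    then obtain u where s: "s \<in> tensor_space B0 B1" and "u \<in> x i +o B0"
      and "coprod u \<in> s +o tensor_space B1 B0"
      by blast
    moreover then obtain b where "u = x i + b" and b: "b \<in> B0"
      by (blast elim: coset_memE)
    ultimately have "coprod (x i + b) \<in> s +o tensor_space B1 B0" by blast
    then have d: "coprod (x i + b) - s \<in> tensor_space B1 B0" by (simp only: set_minus_plus)
    have "tensor (x i) (counit n) + coprod b - (coprod (x i + b) - s) \<in> tensor_space B1 B0"
      by (rule fs.subspace_diff[OF sub10
            fs.subspace_add[OF sub10 x1 subsetD[OF b00(1) coprod_B0[OF b]]] d])
    moreover have "tensor (x i) (counit n) + coprod b - (coprod (x i + b) - s) = s - tensor (kbar i) (x i)"
      unfolding coprod_linear coprod_x[OF i'] by (simp only: algebra_simps)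
    ultimately have 1: "s - tensor (kbar i) (x i) \<in> tensor_space B1 B0" by (simp only:)
    have 2: "s - tensor (kbar i) (x i) \<in> tensor_space (fs.span grouplikes) B1"
      using fs.subspace_diff[OF subspace_tensor_space s kx] unfolding B0_eq .
    have "s - tensor (kbar i) (x i) \<in> tensor_space (fs.span grouplikes) B0"
      by (rule tensor_space_Int[OF independent_grouplikes subspace_B1 subspace_B0 2 1])
    then show "s \<in> tensor (kbar i) (x i) +o N01"
      unfolding N01_eq B0_eq[symmetric] by (simp only: set_minus_plus)
  next
    fix s assume "s \<in> tensor (kbar i) (x i) +o N01"
    then obtain b where s: "s = tensor (kbar i) (x i) + b" and b: "b \<in> tensor_space B0 B0"
      unfolding N01_eq by (auto elim!: coset_memE)
    have "s \<in> tensor_space B0 B1"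
      unfolding s using kx b b00(2) by (intro fs.subspace_add[OF subspace_tensor_space]) auto
    moreover have "coprod (x i) - s = tensor (x i) (counit n) - b"
      unfolding s coprod_x[OF i'] by (simp only: algebra_simps)
    moreover have "tensor (x i) (counit n) - b \<in> tensor_space B1 B0"
      using x1 b b00(1) by (intro fs.subspace_diff[OF sub10]) auto
    ultimately have "s \<in> tensor_space B0 B1" "coprod (x i) \<in> s +o tensor_space B1 B0"
      by (simp_all only: set_minus_plus[symmetric])
    moreover have "x i \<in> x i +o B0"
      using fs.subspace_0[OF subspace_B0] by (force simp: elt_set_plus_def)
    ultimately show "s \<in> {s \<in> tensor_space B0 B1. \<exists>u\<in>x i +o B0. coprod u \<in> s +o tensor_space B1 B0}"
      by blast
  qed
qed

text \<open>Suppose the coaction on \<open>x\<^sub>i\<close> is written as \<open>\<Sum> g\<^sub>t \<otimes> w\<^sub>t\<close>. The group-like elements being independent,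
  some linear form \<open>f\<close> sends each \<open>g\<close> to its eigenvalue on \<open>x\<^sub>j\<close>. Applying \<open>f \<otimes> id\<close> gives
  \<open>\<Sum> f(g\<^sub>t) w\<^sub>t = f(g) x\<^sub>i\<close> modulo \<open>B\<^sub>0\<close> for the group-like element \<open>g\<close> by which \<open>x\<^sub>i\<close> coacts, and so the
  braiding is independent of the way in which the coaction is written.\<close>

lemma braiding_x:
  assumes i: "i \<in> {1..n-1}" and j: "j \<in> {1..n-1}"
  shows "braiding n r p (x_gr n r p i) (x_gr n r p j) =
    tensor (fscale (eigenvalue j (kbar i)) (x j)) (x i) +o N11"
proof -
  let ?C = "tensor (fscale (eigenvalue j (kbar i)) (x j)) (x i) +o N11"
  let ?val = "\<lambda>(m::nat) g v. (\<Sum>t<m. gr_tensor B 1 1 (ad_act n r p (g t) (x_gr n r p j)) (v t)) + N11"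
  let ?ok = "\<lambda>(m::nat) g v. (\<forall>t<m. g t \<in> SLG n r p \<and> v t \<in> V_gr n r p) \<and>
     coact n r p (x_gr n r p i) = (\<Sum>t<m. gr_tensor B 0 1 (gr_class B 0 (g t)) (v t)) + N01"
  have span_x: "fs.span (x ` {1..n-1}) \<subseteq> B1"
    using x_in_B1 subspace_B1 by (intro fs.span_minimal) auto
  have uniq: "?val m g v = ?C" if ok: "?ok m g v" for m g v
  proof -
    have "\<forall>t\<in>{..<m}. \<exists>w. v t = w +o B0 \<and> w \<in> B1"
      using ok span_x unfolding V_gr_def gr_class_1 by blast
    then obtain w where w: "\<And>t. t < m \<Longrightarrow> v t = w t +o B0" "\<And>t. t < m \<Longrightarrow> w t \<in> B1"
      by (metis lessThan_iff)
    have gS: "g t \<in> SLG n r p" "g t \<in> grouplikes" if "t < m" for t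
      using ok that SLG_grouplike by blast+
    have "(\<Sum>t<m. gr_tensor B 0 1 (gr_class B 0 (g t)) (v t)) = (\<Sum>t<m. tensor (g t) (w t) +o N01)"
      using w(1) gS(2) gr_tensor_0_1 by (intro sum.cong refl) simp
    with ok have "tensor (kbar i) (x i) +o N01 = (\<Sum>t<m. tensor (g t) (w t)) +o N01"
      by (simp only: coact_x[OF i] coset_sum[OF subspace_N01])
    then have "(\<Sum>t<m. tensor (g t) (w t)) +o N01 = tensor (kbar i) (x i) +o N01" by (rule sym)
    then have "(\<Sum>t<m. tensor (g t) (w t)) - tensor (kbar i) (x i) \<in> N01"
      by (simp only: coset_eq[OF subspace_N01])
    then have d: "(\<Sum>t<m. tensor (g t) (w t)) - tensor (kbar i) (x i) \<in> tensor_space B0 B0"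
      by (simp only: N01_eq)
    obtain f where f: "linear_form f" "\<forall>h\<in>grouplikes. f h = eigenvalue j h"
      using independent_linear_form[OF independent_grouplikes] by blast
    have fk: "f (kbar i) = eigenvalue j (kbar i)" using f(2) kbar_grouplike[OF i] by blast
    have "contract f ((\<Sum>t<m. tensor (g t) (w t)) - tensor (kbar i) (x i)) \<in> B0"
      by (rule contract_in[OF f(1) subspace_B0 d])
    moreover have "contract f ((\<Sum>t<m. tensor (g t) (w t)) - tensor (kbar i) (x i)) =
        (\<Sum>t<m. fscale (f (g t)) (w t)) - fscale (eigenvalue j (kbar i)) (x i)"
      by (simp only: contract_simps[OF f(1)] contract_sum[OF f(1)] fk)
    moreover have "(\<Sum>t<m. fscale (f (g t)) (w t)) = (\<Sum>t<m. fscale (eigenvalue j (g t)) (w t))"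
      using f(2) gS(2) by (intro sum.cong refl) simp
    ultimately have e: "(\<Sum>t<m. fscale (eigenvalue j (g t)) (w t)) - fscale (eigenvalue j (kbar i)) (x i) \<in> B0"
      by (simp only:)
    have "gr_tensor B 1 1 (ad_act n r p (g t) (x_gr n r p j)) (v t) =
        tensor (fscale (eigenvalue j (g t)) (x j)) (w t) +o N11" if "t < m" for t
      unfolding ad_act_x[OF gS(1)[OF that] j] w(1)[OF that]
      using x_in_B1[OF j] subspace_B1 w(2)[OF that] by (intro gr_tensor_1_1 fs.subspace_scale)
    then have "(\<Sum>t<m. gr_tensor B 1 1 (ad_act n r p (g t) (x_gr n r p j)) (v t)) =
        (\<Sum>t<m. tensor (fscale (eigenvalue j (g t)) (x j)) (w t) +o N11)"
      by (intro sum.cong refl) simp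
    then have "?val m g v = (\<Sum>t<m. tensor (fscale (eigenvalue j (g t)) (x j)) (w t)) +o N11"
      by (simp only: coset_sum[OF subspace_N11])
    also have "\<dots> = ?C"
      unfolding coset_eq[OF subspace_N11]
    proof -
      have "tensor (x j) ((\<Sum>t<m. fscale (eigenvalue j (g t)) (w t)) - fscale (eigenvalue j (kbar i)) (x i)) \<in> N11"
        unfolding N11_eq using x_in_B1[OF j] e
        by (intro set_plus_right zero_in_tensor_space tensor_in_tensor_space)
      then show "(\<Sum>t<m. tensor (fscale (eigenvalue j (g t)) (x j)) (w t)) -
          tensor (fscale (eigenvalue j (kbar i)) (x j)) (x i) \<in> N11"
        by (simp only: tensor_simps tensor_sum_right)
    qed
    finally show ?thesis .
  qed
  have "?ok 1 (\<lambda>_. kbar i) (\<lambda>_. x_gr n r p i)"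
  proof (intro conjI allI impI)
    show "kbar i \<in> SLG n r p" by (rule kbar_in_SLG[OF i])
    show "x_gr n r p i \<in> V_gr n r p"
      unfolding V_gr_def x_gr_def using i by (intro imageI fs.span_base) auto
    show "coact n r p (x_gr n r p i) = (\<Sum>t<(1::nat). gr_tensor B 0 1 (gr_class B 0 (kbar i)) (x_gr n r p i)) + N01"
    proof -
      have "(\<Sum>t<(1::nat). tensor (kbar i) (x i) +o N01) + N01 = (\<Sum>t<(1::nat). tensor (kbar i) (x i)) +o N01"
        by (rule coset_sum[OF subspace_N01])
      also have "(\<Sum>t<(1::nat). tensor (kbar i) (x i)) = tensor (kbar i) (x i)"
        by (simp only: One_nat_def sum.lessThan_Suc lessThan_0 sum.empty add_0)
      finally show ?thesis
        unfolding coact_x[OF i] unfolding x_gr_eq gr_tensor_0_1[OF kbar_grouplike[OF i]] by (rule sym)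
    qed
  qed
  then have ok1: "\<exists>m g v. ?ok m g v" by (intro exI)
  define val ok C where "val = ?val" and "ok = ?ok" and "C = ?C"
  have uniq': "val m g v = C" if "ok m g v" for m g v
    using that unfolding val_def ok_def C_def by (rule uniq)
  have ok1': "\<exists>m g v. ok m g v"
    unfolding ok_def by (rule ok1)
  have "{val m g v | m g v. ok m g v} = {C}"
    using uniq' ok1' by blast
  then have "\<Union>{val m g v | m g v. ok m g v} = C" by (simp only: Union_insert Union_empty Un_empty_right)
  then show ?thesis unfolding braiding_def val_def ok_def C_def .
qed

lemma B0_offdiag: "u \<in> B0 \<Longrightarrow> i \<noteq> j \<Longrightarrow> u (T_gen i j) = 0"
proof -
  assume u: "u \<in> B0" and ij: "i \<noteq> j"
  have "fs.span grouplikes \<subseteq> {u. u (T_gen i j) = 0}"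
  proof (rule fs.span_minimal)
    show "grouplikes \<subseteq> {u. u (T_gen i j) = 0}"
      using ij by (auto simp: grouplikes_def diag_char_T_gen)
  qed (auto simp: fs.subspace_def fscale_def)
  with u show ?thesis unfolding B0_eq by blast
qed

lemma x_T_gen:
  assumes "i \<in> {1..n-1}" shows "x i (T_gen i (Suc i)) \<noteq> 0"
proof -
  have i: "i \<in> {1..n}" "Suc i \<in> {1..n}" using assms by auto
  have "x i (T_gen i (Suc i)) = inverse (\<kappa> i (Suc i))"
    using i by (simp add: x_eq x_word_def E_word_Cons)
  then show ?thesis using kappa_nonzero[OF i] by simp
qed

text \<open>Group-like elements are diagonal, so \<open>B\<^sub>0\<close> vanishes on \<open>T_i^{i+1}\<close> while \<open>x\<^sub>i\<close> does not. Evaluating both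
  tensor factors at such letters detects the class of \<open>x\<^sub>j \<otimes> x\<^sub>i\<close>, which makes the braiding coefficients
  unique.\<close>

lemma tensor_x_notin_N11:
  assumes "i \<in> {1..n-1}" "j \<in> {1..n-1}" "fscale c (tensor (x j) (x i)) \<in> N11"
  shows "c = 0"
proof -
  let ?e = "(T_gen j (Suc j), T_gen i (Suc i)) :: 'k free_alg \<times> 'k free_alg"
  have sub: "fs.subspace {z. z ?e = (0::'k)}"
    by (auto simp: fs.subspace_def fscale_def)
  have "tensor_space B0 B1 \<subseteq> {z. z ?e = 0}" "tensor_space B1 B0 \<subseteq> {z. z ?e = 0}"
    using B0_offdiag by (intro tensor_space_subset[OF sub]; simp add: tensor_def)+
  moreover obtain a b where "fscale c (tensor (x j) (x i)) = a + b"
    "a \<in> tensor_space B0 B1" "b \<in> tensor_space B1 B0"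
    using assms(3) unfolding N11_eq by (rule set_plus_elim)
  ultimately have "fscale c (tensor (x j) (x i)) = a + b" "a ?e = 0" "b ?e = 0" by blast+
  then have "fscale c (tensor (x j) (x i)) ?e = 0" by simp
  then show ?thesis
    using x_T_gen[OF assms(1)] x_T_gen[OF assms(2)] by (simp add: tensor_def fscale_def)
qed

lemma gr_scale2_coset: "gr_scale2 B 1 1 c (z +o N11) = fscale c z +o N11"
proof (intro equalityI subsetI)
  fix y assume "y \<in> gr_scale2 B 1 1 c (z +o N11)"
  then obtain a b where ab: "y = fscale c (z + a) + b" "a \<in> N11" "b \<in> N11"
    unfolding gr_scale2_def by (auto elim!: set_plus_elim coset_memE)
  have "y - fscale c z = fscale c a + b" unfolding ab(1) fs.scale_right_distrib by (simp only: algebra_simps)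
  then have "y - fscale c z \<in> N11"
    using ab(2,3) subspace_N11 by (simp only: fs.subspace_add fs.subspace_scale)
  then show "y \<in> fscale c z +o N11" by (simp only: set_minus_plus)
next
  fix y assume "y \<in> fscale c z +o N11"
  then obtain b where b: "y = fscale c z + b" "b \<in> N11" by (auto elim!: coset_memE)
  have "z \<in> z +o N11" using fs.subspace_0[OF subspace_N11] by (force simp: elt_set_plus_def)
  then show "y \<in> gr_scale2 B 1 1 c (z +o N11)"
    unfolding gr_scale2_def b(1) using b(2) by (intro set_plus_intro imageI)
qed

lemma braiding_has_matrix_iff:
  "braiding_has_matrix n r p l \<longleftrightarrow> (\<forall>i\<in>{1..n-1}. \<forall>j\<in>{1..n-1}. l i j = eigenvalue j (kbar i))"
proof -
  have "braiding n r p (x_gr n r p i) (x_gr n r p j) =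
      gr_scale2 B 1 1 (l i j) (gr_tensor B 1 1 (x_gr n r p j) (x_gr n r p i)) \<longleftrightarrow>
      l i j = eigenvalue j (kbar i)" if ij: "i \<in> {1..n-1}" "j \<in> {1..n-1}" for i j
  proof -
    let ?q = "eigenvalue j (kbar i)"
    have "tensor (fscale ?q (x j)) (x i) - fscale (l i j) (tensor (x j) (x i)) =
        fscale (?q - l i j) (tensor (x j) (x i))"
      by (simp only: tensor_simps fs.scale_left_diff_distrib)
    then have "tensor (fscale ?q (x j)) (x i) +o N11 = fscale (l i j) (tensor (x j) (x i)) +o N11 \<longleftrightarrow>
        fscale (?q - l i j) (tensor (x j) (x i)) \<in> N11"
      by (simp only: coset_eq[OF subspace_N11])
    also have "\<dots> \<longleftrightarrow> ?q - l i j = 0"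
      using tensor_x_notin_N11[OF ij] fs.subspace_0[OF subspace_N11]
      by (metis (no_types) fs.scale_zero_left)
    finally show ?thesis
      unfolding braiding_x[OF ij] unfolding x_gr_eq gr_tensor_1_1[OF x_in_B1[OF ij(2)] x_in_B1[OF ij(1)]] gr_scale2_coset
      by auto
  qed
  then show ?thesis unfolding braiding_has_matrix_def by blast
qed

lemma eigenvalue_kbar:
  assumes "i \<in> {1..n-1}" "j \<in> {1..n-1}"
  shows "eigenvalue j (kbar i) = \<kappa> (Suc i) j * \<kappa> i (Suc j) / (\<kappa> (Suc i) (Suc j) * \<kappa> i j)"
proof -
  have "j \<in> {1..n}" "Suc j \<in> {1..n}" using assms by auto
  then have "eigenvalue j (kbar i) = inverse (\<kappa> i j) * \<kappa> (Suc i) j * inverse (inverse (\<kappa> i (Suc j)) * \<kappa> (Suc i) (Suc j))"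
    by (simp only: eigenvalue_def kbar_def diag_char_T_gen simp_thms if_True)
  then show ?thesis by (simp add: field_simps)
qed

section \<open>Cartan type\<close>

text \<open>In the product of the coefficients for \<open>(i, j)\<close> and \<open>(j, i)\<close> the entries of \<open>\<kappa>\<close> combine to products
  \<open>\<kappa>^a_b \<kappa>^b_a\<close>, equal to \<open>r\<close> for \<open>a \<noteq> b\<close> and to \<open>r\<^sup>2\<close> for \<open>a = b\<close>: two of them in the numerator, for
  \<open>(i+1, j)\<close> and \<open>(i, j+1)\<close>, and two in the denominator, for \<open>(i+1, j+1)\<close> and \<open>(i, j)\<close>. Counting the equal
  pairs gives \<open>q^{a_{ij}}\<close> with \<open>q = 1/r\<close> and all \<open>d\<^sub>i = 1\<close>.\<close>

lemma cartan_A: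
  assumes r1: "r \<noteq> 1" and l: "braiding_has_matrix n r p l"
  shows "cartan_FL_type {1..n-1} l cartan_matrix_A"
proof -
  have L: "l i j * l j i = inverse r powi cartan_matrix_A i j"
    if i: "i \<in> {1..n-1}" and j: "j \<in> {1..n-1}" for i j
  proof -
    have m: "i \<in> {1..n}" "Suc i \<in> {1..n}" "j \<in> {1..n}" "Suc j \<in> {1..n}" using i j by auto
    have gen: "(a * b / (c * d)) * (a' * b' / (c' * d')) = (a * b') * (b * a') / ((c * c') * (d * d'))"
      for a b c d a' b' c' d' :: 'k by (simp only: times_divide_times_eq mult_ac)
    have "l i j * l j i =
        (\<kappa> (Suc i) j * \<kappa> i (Suc j) / (\<kappa> (Suc i) (Suc j) * \<kappa> i j)) *
        (\<kappa> (Suc j) i * \<kappa> j (Suc i) / (\<kappa> (Suc j) (Suc i) * \<kappa> j i))"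
      using l i j by (simp only: braiding_has_matrix_iff eigenvalue_kbar)
    also have "\<dots> = (\<kappa> (Suc i) j * \<kappa> j (Suc i)) * (\<kappa> i (Suc j) * \<kappa> (Suc j) i) /
        ((\<kappa> (Suc i) (Suc j) * \<kappa> (Suc j) (Suc i)) * (\<kappa> i j * \<kappa> j i))"
      by (rule gen)
    also have "\<dots> = inverse r powi cartan_matrix_A i j"
    proof -
      have P: "\<kappa> a b * \<kappa> b a = (if a = b then r * r else r)" if "a \<in> {1..n}" "b \<in> {1..n}" for a b
        using kappa_symmetric[OF that] by (simp add: kappa_diag)
      consider "i = j" | "j = Suc i" | "i = Suc j" | "i \<noteq> j" "j \<noteq> Suc i" "i \<noteq> Suc j" by blast
      then show ?thesis unfolding P[OF m(2,3)] P[OF m(1,4)] P[OF m(2,4)] P[OF m(1,3)]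
        using r by cases (simp_all add: cartan_matrix_A_def power_int_minus power2_eq_square inverse_eq_divide)
    qed
    finally show ?thesis .
  qed
  have "generalized_cartan_matrix {1..n-1} cartan_matrix_A"
    by (auto simp: generalized_cartan_matrix_def cartan_matrix_A_def)
  moreover have "inverse r \<noteq> 0" "inverse r \<noteq> 1" using r r1 by auto
  moreover have "cartan_matrix_A i j = cartan_matrix_A j i" for i j
    by (auto simp: cartan_matrix_A_def)
  ultimately show ?thesis unfolding cartan_FL_type_def
    using L by (intro conjI exI[of _ "inverse r"] exI[of _ "\<lambda>_. 1"]) auto
qed

end

theorem proposition2p1:
  fixes n :: nat and r :: "'k::{alg_closed_field, field_char_0}" and p :: "nat \<Rightarrow> nat \<Rightarrow> 'k"
  assumes "n \<ge> 2" and "r \<noteq> 0" and "r \<noteq> 1"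
    and "\<And>i j. 1 \<le> i \<Longrightarrow> i < j \<Longrightarrow> j \<le> n \<Longrightarrow> p i j \<noteq> 0"
  shows "(\<exists>l. braiding_has_matrix n r p l) \<and>
    (\<forall>l. braiding_has_matrix n r p l \<longrightarrow> cartan_FL_type {1..n-1} l cartan_matrix_A)"
proof -
  interpret frt n r p
    using assms(2,4) by unfold_locales
  have "braiding_has_matrix n r p (\<lambda>i j. eigenvalue j (kbar i))"
    by (simp add: braiding_has_matrix_iff)
  then show ?thesis using cartan_A[OF assms(3)] by blast
qed

end
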